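(* Let $0<\alpha<1$, let $n\geq 1$ be an integer, and let $f$ be an analytic function in a complex domain $D$ containing the closed interval $[0,1]$ in its interior. Let $C$ be a closed complex integral path contained in $D\setminus[0,1]$ and encircling $[0,1]$ in the positive sense, parameterized by $z=\varphi(u)$, $0\leq u\leq u_{\rm p}$, where $\varphi$ is periodic with period $u_{\rm p}>0$. Suppose that (1) the parameterization function $\varphi(w)$ of $C$ is analytic in the strip domain $D_d=\{w\in\mathbb{C} : |\operatorname{Im}w|<d\}$, where $d>0$; (2) the domain $\varphi(D_d)=\{\varphi(w) : w\in D_d\}$ is contained in $\mathbb{C}\setminus[0,1]$; and (3) the function $f(z)$ is analytic in $\varphi(D_d)$. Then for arbitrary $0<d'<d$, $$\left|\mathrm{f.p.}\int_0^1 x^{\alpha-1-n}f(x)\,\mathrm{d}x-I_N^{(n,\alpha)}[f]\right|\leq\frac{u_{\rm p}}{\pi}\,\mathscr{N}(f,\alpha,n,d')\,\frac{\exp(-2\pi d'N/u_{\rm p})}{1-\exp(-2\pi d'N/u_{\rm p})},$$ where $$\mathscr{N}(f,\alpha,n,d')=\max_{|\operatorname{Im}w|=d'}\left|\varphi(w)^{-n}f(\varphi(w))\Psi_{\alpha}(\varphi(w))\varphi'(w)\right|.$$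
   Context: For $0<\alpha<1$, an integer $n\geq 1$ and a function $f$ analytic on the closed interval $[0,1]$, the Hadamard finite-part integral is defined by $$\mathrm{f.p.}\int_0^1 x^{\alpha-1-n}f(x)\,\mathrm{d}x=\lim_{\epsilon\downarrow 0}\left\{\int_{\epsilon}^1 x^{\alpha-1-n}f(x)\,\mathrm{d}x-\sum_{k=0}^{n-1}\frac{\epsilon^{\alpha-n+k}}{k!\,(n-k-\alpha)}f^{(k)}(0)\right\}.$$ The function $\Psi_\alpha$ is defined by $$\Psi_{\alpha}(z)=\alpha^{-1}z^{-1}F(\alpha,1;\alpha+1;z^{-1}),$$ where $F(a,b;c;w)$ is the Gauss hypergeometric function ${}_2F_1$, i.e. $\sum_{k\geq 0}\frac{(a)_k(b)_k}{(c)_k k!}w^k$ for $|w|<1$ (with $(a)_0=1$, $(a)_k=a(a+1)\cdots(a+k-1)$), analytically continued to $\mathbb{C}\setminus[1,\infty)$ (principal branch); $\Psi_\alpha$ is a single-valued analytic function on $\mathbb{C}\setminus[0,1]$. For a positive integer $N$ (the number of sampling points), the approximation by the trapezoidal formula with equal mesh is $$I_N^{(n,\alpha)}[f]=\frac{h}{2\pi\mathrm{i}}\sum_{k=0}^{N-1}\varphi(kh)^{-n}f(\varphi(kh))\Psi_{\alpha}(\varphi(kh))\varphi'(kh)+\sum_{k=0}^{n-1}\frac{f^{(k)}(0)}{k!\,(\alpha-n+k)},\qquad h=\frac{u_{\rm p}}{N}.$$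
   Formalization: "Encircling [0,1] in the positive sense" is taken as winding number 1 about each point of [0,1] and, additionally, 0 about each point outside D, so C encloses no hole of D; otherwise the claim fails, e.g. f(z)=1/(z-5), D=C minus {5}, C the circle |z|=10. *)

theory Defs
  imports "HOL-Complex_Analysis.Complex_Analysis"
begin

definition strip :: "real \<Rightarrow> complex set" where
  "strip d = {w. \<bar>Im w\<bar> < d}"

definition slit_plane :: "complex set" where
  "slit_plane = - complex_of_real ` {1..}"

definition hypergeom_continuation ::
    "complex \<Rightarrow> complex \<Rightarrow> complex \<Rightarrow> (complex \<Rightarrow> complex) \<Rightarrow> bool" where
  "hypergeom_continuation a b c g \<longleftrightarrow>
     g holomorphic_on slit_plane \<and>
     (\<forall>w\<in>ball 0 1.
        (\<lambda>k. pochhammer a k * pochhammer b k / (pochhammer c k * fact k) * w ^ k) sums g w)"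

(* The principal branch.  By hypergeom_continuation_unique below, the chosen function is
   determined on the slit plane; on the cut [1, oo) it is unspecified. *)
definition hypergeom :: "complex \<Rightarrow> complex \<Rightarrow> complex \<Rightarrow> complex \<Rightarrow> complex" where
  "hypergeom a b c = (SOME g. hypergeom_continuation a b c g)"

lemma starlike_slit_plane: "starlike slit_plane"
  unfolding slit_plane_def by (rule starlike_slotted_complex_plane_right)

lemma open_slit_plane: "open slit_plane"
proof -
  have "complex_of_real ` {1..} = {w. Im w = 0} \<inter> {w. Re w \<ge> 1}"
  proof (intro equalityI subsetI)
    fix w assume "w \<in> {w. Im w = 0} \<inter> {w. Re w \<ge> 1}"
    then have "w = complex_of_real (Re w)" "Re w \<in> {1..}"
      by (simp_all add: complex_eq_iff)
    then show "w \<in> complex_of_real ` {1..}" by (rule image_eqI)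
  qed auto
  moreover have "closed ({w. Im w = 0} \<inter> {w. Re w \<ge> 1})"
    by (intro closed_Int closed_halfspace_Re_ge closed_Collect_eq continuous_intros)
  ultimately show ?thesis
    unfolding slit_plane_def by (metis open_Compl)
qed

lemma hypergeom_continuation_unique:
  assumes g: "hypergeom_continuation a b c g" and h: "hypergeom_continuation a b c h"
    and w: "w \<in> slit_plane"
  shows "g w = h w"
proof (rule analytic_continuation_open[of "ball 0 1" slit_plane g h w])
  show "ball 0 1 \<subseteq> slit_plane"
    by (auto simp: slit_plane_def)
  show "g z = h z" if "z \<in> ball 0 1" for z
    using g h that sums_unique2 unfolding hypergeom_continuation_def by blast
  show "connected slit_plane"
    by (intro starlike_imp_connected starlike_slit_plane)
  show "g holomorphic_on slit_plane" "h holomorphic_on slit_plane"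
    using g h by (simp_all add: hypergeom_continuation_def)
qed (use w in \<open>simp_all add: open_slit_plane\<close>)

definition Psi :: "real \<Rightarrow> complex \<Rightarrow> complex" where
  "Psi \<alpha> z = inverse (complex_of_real \<alpha>) * inverse z *
     hypergeom (complex_of_real \<alpha>) 1 (complex_of_real \<alpha> + 1) (inverse z)"

text \<open>For \<open>f\<close> analytic at 0, the one-sided derivatives along \<open>[0,1]\<close> are the complex
  derivatives \<open>(deriv ^^ k) f 0\<close>.\<close>
definition finite_part_integral :: "nat \<Rightarrow> real \<Rightarrow> (complex \<Rightarrow> complex) \<Rightarrow> complex" where
  "finite_part_integral n \<alpha> f =
     Lim (at_right 0) (\<lambda>\<epsilon>::real.
       integral {\<epsilon>..1}
         (\<lambda>x. complex_of_real (x powr (\<alpha> - 1 - real n)) * f (complex_of_real x))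
       - (\<Sum>k<n. complex_of_real (\<epsilon> powr (\<alpha> - real n + real k) /
                   (fact k * (real n - real k - \<alpha>))) * (deriv ^^ k) f 0))"

definition integrand ::
    "nat \<Rightarrow> real \<Rightarrow> (complex \<Rightarrow> complex) \<Rightarrow> (complex \<Rightarrow> complex) \<Rightarrow> complex \<Rightarrow> complex" where
  "integrand n \<alpha> f \<phi> w =
     \<phi> w powi (- int n) * f (\<phi> w) * Psi \<alpha> (\<phi> w) * deriv \<phi> w"

definition trapezoidal_approx ::
    "nat \<Rightarrow> nat \<Rightarrow> real \<Rightarrow> (complex \<Rightarrow> complex) \<Rightarrow> (complex \<Rightarrow> complex) \<Rightarrow> real \<Rightarrow> complex" where
  "trapezoidal_approx N n \<alpha> f \<phi> up =
     (let h = up / real N in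
        complex_of_real h / (2 * complex_of_real pi * \<i>) *
          (\<Sum>k<N. integrand n \<alpha> f \<phi> (complex_of_real (real k * h)))
        + (\<Sum>k<n. (deriv ^^ k) f 0 / complex_of_real (fact k * (\<alpha> - real n + real k))))"

(* A genuine maximum: GREATEST is unspecified unless the supremum is attained. *)
definition max_norm :: "nat \<Rightarrow> real \<Rightarrow> (complex \<Rightarrow> complex) \<Rightarrow> (complex \<Rightarrow> complex) \<Rightarrow> real \<Rightarrow> real"
  where
  "max_norm n \<alpha> f \<phi> d' =
     (GREATEST m. m \<in> (\<lambda>w. norm (integrand n \<alpha> f \<phi> w)) ` {w. \<bar>Im w\<bar> = d'})"

definition param_path :: "(complex \<Rightarrow> complex) \<Rightarrow> real \<Rightarrow> real \<Rightarrow> complex" where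
  "param_path \<phi> up = \<phi> \<circ> linepath 0 (complex_of_real up)"

(* The second conjunct excludes paths that also enclose a hole of D, where f need not be
   analytic.  It is automatic if D is simply connected, or if the path is a Jordan curve whose
   interior lies in D. *)
definition encircles_in ::
    "(real \<Rightarrow> complex) \<Rightarrow> complex set \<Rightarrow> complex set \<Rightarrow> bool" where
  "encircles_in C K D \<longleftrightarrow>
     (\<forall>z\<in>K. winding_number C z = 1) \<and> (\<forall>z. z \<notin> D \<longrightarrow> winding_number C z = 0)"

end

theory Submission
  imports Defs
begin

text \<open>
  Substituting \<open>x = t\<^sup>1\<^sup>/\<^sup>\<alpha>\<close> gives \<open>\<Psi>\<^sub>\<alpha>(z) = \<alpha>\<^sup>-\<^sup>1 \<integral>\<^sub>0\<^sup>1 dt / (z - t\<^sup>1\<^sup>/\<^sup>\<alpha>)\<close>, with a continuous integrand.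
  Write \<open>f(z) = \<Sum>\<^bsub>k<n\<^esub> f\<^sup>(\<^sup>k\<^sup>)(0) z\<^sup>k / k! + z\<^sup>n g(z)\<close>. By Fubini and the global Cauchy formula, both
  the contour integral of \<open>z\<^sup>-\<^sup>n f(z) \<Psi>\<^sub>\<alpha>(z) / 2\<pi>i\<close> and the finite part integral (up to the explicit sum
  over \<open>k\<close>) are equal to \<open>\<alpha>\<^sup>-\<^sup>1 \<integral>\<^sub>0\<^sup>1 g(t\<^sup>1\<^sup>/\<^sup>\<alpha>) dt\<close>, because \<open>1 / (z\<^sup>m (z - x))\<close> integrates to \<open>0\<close> for \<open>m \<ge> 1\<close>.

  It remains to bound the error of the trapezoidal rule for a periodic function \<open>A\<close> holomorphic in a
  strip. With \<open>E(w) = exp (2\<pi>iw / h)\<close>, the function \<open>(A(w) - A(0)) / (E(w) - 1)\<close> has a removable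
  singularity at \<open>0\<close>, so its integrals over a period on the lines \<open>Im w = \<plusminus>d'\<close> agree. Up to terms
  controlled by \<open>exp (-2\<pi>d'/h)\<close>, this equality says that \<open>h A(0)\<close> is the integral of \<open>A\<close>.
\<close>

subsection \<open>The trapezoidal rule for periodic functions\<close>

lemma open_strip: "open (strip d)"
  unfolding strip_def by (intro open_Collect_less continuous_intros)

lemma convex_strip: "convex (strip d)"
proof -
  have "strip d = {w. Im w < d} \<inter> {w. Im w > - d}"
    by (auto simp: strip_def)
  then show ?thesis
    by (simp add: convex_Int convex_halfspace_Im_lt convex_halfspace_Im_gt)
qed

lemma add_of_real_in_strip [simp]: "w + of_real x \<in> strip d \<longleftrightarrow> w \<in> strip d"
  by (simp add: strip_def)

lemma of_real_in_strip: "0 < d \<Longrightarrow> of_real x \<in> strip d"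
  by (simp add: strip_def)

lemma holomorphic_on_strip_translate:
  assumes "f holomorphic_on strip d"
  shows "(\<lambda>w. f (w + of_real x)) holomorphic_on strip d"
  using holomorphic_on_compose_gen[of "\<lambda>w. w + of_real x" "strip d" f "strip d"] assms
  by (force simp: o_def intro: holomorphic_intros)

lemma holomorphic_primitive_convex_open:
  assumes "f holomorphic_on S" "open S" "convex S"
  obtains P where "\<And>w. w \<in> S \<Longrightarrow> (P has_field_derivative f w) (at w)"
proof -
  have "\<And>x. x \<in> interior S - {} \<Longrightarrow> f field_differentiable at x"
    using assms holomorphic_on_imp_differentiable_at interior_open by blast
  then obtain P where "\<And>w. w \<in> S \<Longrightarrow> (P has_field_derivative f w) (at w within S)"
    using holomorphic_convex_primitive[of S "{}" f] assms holomorphic_on_imp_continuous_on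
    by blast
  then show ?thesis
    using that assms(2) by (metis at_within_open)
qed

lemma has_contour_integral_linepath_primitive:
  assumes "\<And>w. w \<in> S \<Longrightarrow> (P has_field_derivative f w) (at w)" "closed_segment a b \<subseteq> S"
  shows "(f has_contour_integral (P b - P a)) (linepath a b)"
  using contour_integral_primitive[of S P f "linepath a b"] assms
    has_field_derivative_at_within by (metis path_image_linepath pathfinish_linepath
      pathstart_linepath valid_path_linepath)

text \<open>The increment has derivative \<open>f (w + p) - f w = 0\<close> on the convex set
  \<open>T\<close>. It stands for the integral of \<open>f\<close> over one period, so the lemma
  replaces a contour shift: period integrals at different heights agree. Only \<open>T\<close>, not
  \<open>S\<close>, has to stay inside \<open>S\<close> under the translation.\<close>

lemma primitive_periodic_increment:
  assumes P: "\<And>w. w \<in> S \<Longrightarrow> (P has_field_derivative f w) (at w)"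
    and T: "convex T" "T \<subseteq> S" "\<And>w. w \<in> T \<Longrightarrow> w + p \<in> S"
    and per: "\<And>w. w \<in> T \<Longrightarrow> f (w + p) = f w"
    and uv: "u \<in> T" "v \<in> T"
  shows "P (u + p) - P u = P (v + p) - P v"
proof -
  have "((\<lambda>w. P (w + p) - P w) has_field_derivative 0) (at w within T)" if "w \<in> T" for w
  proof -
    have "((\<lambda>w. P (w + p)) has_field_derivative f (w + p)) (at w)"
      using DERIV_shift P T(3) that by blast
    from DERIV_diff[OF this P] T(2) per that show ?thesis
      by (metis DERIV_subset diff_self subset_UNIV subsetD)
  qed
  from has_field_derivative_zero_constant[OF T(1) this] uv show ?thesis
    by metis
qed

lemma norm_exp_neg_ratio_le:
  fixes E :: complex
  assumes "norm E = q" "q < 1"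
  shows "norm (E / (1 - E)) \<le> q / (1 - q)"
proof -
  have "1 - q \<le> norm (1 - E)"
    using norm_triangle_ineq2[of 1 E] assms by simp
  then show ?thesis
    using assms by (auto simp: norm_divide intro!: divide_left_mono mult_pos_pos frac_le)
qed

text \<open>A primitive is \<open>- Ln (1 - exp (c * w)) / c\<close>: since
  \<open>norm (exp (c * w)) < 1\<close>, the argument of the principal logarithm stays in the right
  half-plane. Its values at the two endpoints agree because \<open>exp (c * w)\<close> has period
  \<open>b\<close>. The two signs serve a line above and a line below the real axis.\<close>

lemma has_contour_integral_exp_ratio:
  fixes b y :: real and c a :: complex
  assumes c: "c \<noteq> 0" "c * of_real b = 2 * pi * \<i> \<or> c * of_real b = - (2 * pi * \<i>)"
    and lt: "\<And>w. w \<in> closed_segment a (a + of_real b) \<Longrightarrow> norm (exp (c * w)) < 1"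
  shows "((\<lambda>w. exp (c * w) / (1 - exp (c * w))) has_contour_integral 0)
           (linepath a (a + of_real b))"
proof -
  let ?S = "{w. norm (exp (c * w)) < 1}"
  let ?L = "\<lambda>w. - Ln (1 - exp (c * w)) / c"
  have "(?L has_field_derivative exp (c * w) / (1 - exp (c * w))) (at w within ?S)"
    if "w \<in> ?S" for w
  proof -
    have re: "Re (1 - exp (c * w)) > 0"
      using that complex_Re_le_cmod[of "exp (c * w)"] by (simp del: norm_exp_eq_Re)
    then have "1 - exp (c * w) \<notin> \<real>\<^sub>\<le>\<^sub>0" "1 - exp (c * w) \<noteq> 0"
      by (auto simp: complex_nonpos_Reals_iff)
    then show ?thesis
      using c(1) by (auto intro!: derivative_eq_intros simp: divide_simps)
  qed
  from contour_integral_primitive[OF this, of "linepath a (a + of_real b)"]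
  have "((\<lambda>w. exp (c * w) / (1 - exp (c * w))) has_contour_integral
          (?L (a + of_real b) - ?L a)) (linepath a (a + of_real b))"
    using lt by auto
  moreover have "exp (c * (a + of_real b)) = exp (c * a)"
    using c(2) by (auto simp: distrib_left exp_add exp_minus)
  ultimately show ?thesis by simp
qed

text \<open>Here \<open>P (of_real h) - P 0\<close>, called \<open>a\<close> below, is the integral
  of \<open>A\<close> over one period. If \<open>r\<close> is the common integral of the quotient
  \<open>H\<close> on both lines, the lower line bounds \<open>r\<close> and the upper line bounds
  \<open>r + a - of_real h * A 0\<close>, each by \<open>h * M * (q / (1 - q))\<close>. Subtracting
  the two gives the factor 2.\<close>

lemma one_point_error_periodic:
  fixes A P :: "complex \<Rightarrow> complex" and h d d' M :: real
  assumes A: "A holomorphic_on strip d"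
    and per: "\<And>w. w \<in> strip d \<Longrightarrow> A (w + of_real h) = A w"
    and P: "\<And>w. w \<in> strip d \<Longrightarrow> (P has_field_derivative A w) (at w)"
    and h: "0 < h" and d': "0 < d'" "d' < d"
    and M: "\<And>w. \<bar>Im w\<bar> = d' \<Longrightarrow> norm (A w) \<le> M"
  shows "norm ((P (of_real h) - P 0) - of_real h * A 0) \<le>
           2 * h * M * (exp (- 2 * pi * d' / h) / (1 - exp (- 2 * pi * d' / h)))"
proof -
  define q where "q = exp (- 2 * pi * d' / h)"
  define c where "c = 2 * pi * \<i> / of_real h"
  define E where "E = (\<lambda>w. exp (c * w))"
  \<comment> \<open>\<open>S\<close> contains only the zero \<open>0\<close> of \<open>E w - 1\<close>, so a single singularity has to be removed.\<close>
  define S where "S = strip d \<inter> {w. Re w < 3/4 * h} \<inter> {w. Re w > - (3/4 * h)}"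
  \<comment> \<open>Starting points of a period: \<open>T\<close> and its translate by
    \<open>h\<close> both lie in \<open>S\<close> and both avoid the singularity
    \<open>0\<close>.\<close>
  define T where "T = strip d \<inter> {w. Re w < - (h / 4)} \<inter> {w. Re w > - (3/4 * h)}"
  have c0: "c \<noteq> 0" and ch: "c * of_real h = 2 * pi * \<i>"
    using h by (auto simp: c_def)
  have q: "0 < q" "q < 1"
    using h d' by (auto simp: q_def divide_neg_pos)
  have normE: "norm (E w) = exp (- 2 * pi * Im w / h)" for w
    by (simp add: E_def c_def norm_exp_eq_Re Re_divide_of_real field_simps)
  have E_per: "E (w + of_real h) = E w" for w
    by (simp add: E_def distrib_left exp_add ch)
  have M0: "0 \<le> M"
    using order_trans[OF norm_ge_zero M[of "\<i> * of_real d'"]] d' by simp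
  have S: "open S" "convex S" "0 \<in> S" "S \<subseteq> strip d"
  proof -
    show "open S" "convex S"
      unfolding S_def
      by (intro open_Int convex_Int open_strip convex_strip open_halfspace_Re_lt
         open_halfspace_Re_gt convex_halfspace_Re_lt convex_halfspace_Re_gt)+
  qed (use h d' in \<open>auto simp: S_def strip_def\<close>)
  have T: "convex T" "T \<subseteq> S" "\<And>w. w \<in> T \<Longrightarrow> w + of_real h \<in> S"
  proof -
    show "convex T"
      unfolding T_def
      by (intro convex_Int convex_strip convex_halfspace_Re_lt convex_halfspace_Re_gt)
  qed (use h in \<open>auto simp: S_def T_def\<close>)
  have E1: "E w \<noteq> 1" if w: "w \<in> S" "w \<noteq> 0" for w
  proof
    assume "E w = 1"
    then obtain m :: int where m: "Re (c * w) = 0" "Im (c * w) = of_int (2 * m) * pi"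
      unfolding E_def exp_eq_1 by blast
    from m(1) have "Im w = 0" using h by (simp add: c_def Re_divide_of_real)
    moreover have "Re w = h * m"
      using m(2) h by (simp add: c_def Im_divide_of_real field_simps)
    moreover from w(1) have "\<bar>Re w\<bar> < h" using h by (auto simp: S_def)
    ultimately have "\<bar>real_of_int m\<bar> < 1" "w = of_real (h * m)"
      using h by (auto simp: abs_mult complex_eq_iff)
    then have "m = 0" by linarith
    then show False using \<open>w = of_real (h * m)\<close> w(2) by simp
  qed
  \<comment> \<open>Numerator and denominator are both divided by \<open>w\<close>, with the
    derivative as the value at \<open>0\<close>. As \<open>E1' 0 = c\<close> is nonzero,
    \<open>H\<close> is holomorphic on all of \<open>S\<close> and equals the original quotient away
    from \<open>0\<close>.\<close>
  define A1 where "A1 = (\<lambda>w. if w = 0 then deriv (\<lambda>w. A w - A 0) 0 else (A w - A 0) / w)"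
  define E1' where "E1' = (\<lambda>w. if w = 0 then deriv (\<lambda>w. E w - 1) 0 else (E w - 1) / w)"
  define H where "H = (\<lambda>w. A1 w / E1' w)"
  have "A1 holomorphic_on S"
    by (rule pole_theorem_open_0[of "\<lambda>w. A w - A 0" _ 0])
       (use A S in \<open>auto simp: A1_def intro!: holomorphic_intros elim: holomorphic_on_subset\<close>)
  moreover have "E1' holomorphic_on S"
    by (rule pole_theorem_open_0[of "\<lambda>w. E w - 1" _ 0])
       (use S in \<open>auto simp: E1'_def E_def intro!: holomorphic_intros\<close>)
  moreover have "deriv (\<lambda>w. E w - 1) 0 = c"
    unfolding E_def by (rule DERIV_imp_deriv) (auto intro!: derivative_eq_intros)
  then have "E1' w \<noteq> 0" if "w \<in> S" for w
    using E1[OF that] c0 by (auto simp: E1'_def)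
  ultimately have "H holomorphic_on S"
    unfolding H_def by (intro holomorphic_intros) auto
  then obtain Q where Q: "\<And>w. w \<in> S \<Longrightarrow> (Q has_field_derivative H w) (at w)"
    using holomorphic_primitive_convex_open S by metis
  have H_eq: "H w = (A w - A 0) / (E w - 1)" if "w \<noteq> 0" for w
    using that by (simp add: H_def A1_def E1'_def)
  have H_per: "H (w + of_real h) = H w" if "w \<in> T" for w
  proof -
    have "w \<noteq> 0" "w + of_real h \<noteq> 0"
      using that h by (auto simp: T_def complex_eq_iff)
    then show ?thesis
      using H_eq E_per per that by (simp add: T_def)
  qed
  define a where "a = P (of_real h) - P 0"
  \<comment> \<open>Starting at real part \<open>- h / 2\<close> puts \<open>l y\<close> into
    \<open>T\<close> and centres the period at \<open>0\<close>, so the whole segment lies in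
    \<open>S\<close>.\<close>
  define l where "l = (\<lambda>y::real. Complex (- h / 2) y)"
  have l_T: "l y \<in> T" if "\<bar>y\<bar> < d" for y
    using that h by (simp add: l_def T_def strip_def)
  \<comment> \<open>The common value of the integrals of \<open>H\<close> over a period at the
    heights \<open>d'\<close> and \<open>- d'\<close>.\<close>
  define r where "r = Q (l d' + of_real h) - Q (l d')"
  have seg: "Im w = y \<and> Re w \<in> {- h / 2..h / 2}" if "w \<in> closed_segment (l y) (l y + of_real h)" for w y
  proof -
    from that obtain u where u: "0 \<le> u" "u \<le> 1" "w = l y + of_real (u * h)"
      by (auto simp: in_segment scaleR_conv_of_real algebra_simps)
    moreover have "h * u \<le> h" "0 \<le> h * u" using u h by (auto simp: mult_left_le)
    ultimately show ?thesis by (simp add: l_def mult.commute)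
  qed
  have int_H: "(H has_contour_integral r) (linepath (l y) (l y + of_real h))" if y: "\<bar>y\<bar> = d'" for y
  proof -
    have "Q (l y + of_real h) - Q (l y) = r"
      unfolding r_def using y d' l_T by (intro primitive_periodic_increment[OF Q T H_per]) auto
    moreover have "closed_segment (l y) (l y + of_real h) \<subseteq> S"
    proof
      fix w assume "w \<in> closed_segment (l y) (l y + of_real h)"
      from seg[OF this] show "w \<in> S"
        using y d' h by (auto simp: S_def strip_def)
    qed
    ultimately show ?thesis
      using has_contour_integral_linepath_primitive[OF Q] by metis
  qed
  have int_A: "(A has_contour_integral a) (linepath (l y) (l y + of_real h))" if y: "\<bar>y\<bar> = d'" for y
  proof -
    have "P (l y + of_real h) - P (l y) = P (0 + of_real h) - P 0"
      by (rule primitive_periodic_increment[OF P convex_strip[of d]])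
         (use y d' per in \<open>auto simp: l_def of_real_in_strip\<close>, auto simp: strip_def)
    moreover have "closed_segment (l y) (l y + of_real h) \<subseteq> strip d"
    proof
      fix w assume "w \<in> closed_segment (l y) (l y + of_real h)"
      from seg[OF this] show "w \<in> strip d"
        using y d' h by (auto simp: strip_def)
    qed
    ultimately show ?thesis
      using has_contour_integral_linepath_primitive[OF P] by (metis a_def add_0)
  qed
  have int_c: "((\<lambda>w. A 0) has_contour_integral (of_real h * A 0)) (linepath x (x + of_real h))" for x
  proof -
    have "((\<lambda>w. w * A 0) has_field_derivative A 0) (at w)" for w
      by (auto intro!: derivative_eq_intros)
    from has_contour_integral_linepath_primitive[of UNIV, OF this subset_UNIV]
    have "((\<lambda>w. A 0) has_contour_integral ((x + of_real h) * A 0 - x * A 0)) (linepath x (x + of_real h))" .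
    then show ?thesis by (simp add: distrib_right)
  qed
  let ?top = "linepath (l d') (l d' + of_real h)"
  let ?bot = "linepath (l (- d')) (l (- d') + of_real h)"
  have top_q: "norm (E w) = q" if "w \<in> closed_segment (l d') (l d' + of_real h)" for w
    using seg[OF that] by (simp add: normE q_def)
  \<comment> \<open>On the upper line \<open>1 / (E w - 1) = - 1 - E w / (1 - E w)\<close>: the \<open>- 1\<close> produces the integral
    of \<open>A\<close>, and the remainder is exponentially small.\<close>
  have int_Et: "((\<lambda>w. E w / (1 - E w)) has_contour_integral 0) ?top"
    unfolding E_def using c0 ch top_q q by (intro has_contour_integral_exp_ratio) (auto simp: E_def)
  \<comment> \<open>Splitting off the main term leaves
    \<open>(A w - A 0) * (E w / (1 - E w))\<close>. The part with \<open>A 0\<close> has integral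
    \<open>0\<close>, so it may be added back; the integrand becomes
    \<open>A w * (E w / (1 - E w))\<close> and is bounded through \<open>M\<close> alone.\<close>
  have "((\<lambda>w. - (H w + A w - A 0 - A 0 * (E w / (1 - E w)))) has_contour_integral
          (- (r + a - of_real h * A 0 - A 0 * 0))) ?top"
    by (intro has_contour_integral_neg has_contour_integral_add has_contour_integral_diff
        has_contour_integral_lmul int_H int_A int_c int_Et) (use d' in auto)
  then have "((\<lambda>w. A w * (E w / (1 - E w))) has_contour_integral
          (- (r + a - of_real h * A 0 - A 0 * 0))) ?top"
  proof (rule has_contour_integral_eq)
    fix w assume "w \<in> path_image ?top"
    then have w: "w \<in> closed_segment (l d') (l d' + of_real h)" by simp
    have "w \<noteq> 0" "1 - E w \<noteq> 0"
      using seg[OF w] d' top_q[OF w] q by auto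
    then show "- (H w + A w - A 0 - A 0 * (E w / (1 - E w))) = A w * (E w / (1 - E w))"
      by (simp add: H_eq divide_simps) (simp add: algebra_simps)
  qed
  then have "norm (- (r + a - of_real h * A 0 - A 0 * 0)) \<le> (M * (q / (1 - q))) * norm (l d' + of_real h - l d')"
  proof (rule has_contour_integral_bound_linepath)
    fix w assume w: "w \<in> closed_segment (l d') (l d' + of_real h)"
    show "norm (A w * (E w / (1 - E w))) \<le> M * (q / (1 - q))"
      unfolding norm_mult using M[of w] seg[OF w] d' M0 norm_exp_neg_ratio_le[OF top_q[OF w] q(2)]
      by (intro mult_mono) auto
  qed (use M0 q in auto)
  moreover
  have bot_q: "norm (exp (- c * w)) = q" if "w \<in> closed_segment (l (- d')) (l (- d') + of_real h)" for w
  proof -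
    have "norm (exp (- c * w)) = inverse (norm (E w))"
      by (simp add: E_def exp_minus norm_inverse)
    then show ?thesis using seg[OF that] by (simp add: normE q_def exp_minus)
  qed
  have int_Eb: "((\<lambda>w. exp (- c * w) / (1 - exp (- c * w))) has_contour_integral 0) ?bot"
    using c0 ch bot_q q by (intro has_contour_integral_exp_ratio) auto
  \<comment> \<open>On the lower line \<open>norm (E w) = 1 / q\<close>, so
    \<open>1 / (E w - 1) = exp (- c * w) / (1 - exp (- c * w))\<close> is small as a whole and no
    main term splits off. The part with \<open>A 0\<close> again integrates to
    \<open>0\<close>.\<close>
  have "((\<lambda>w. H w + A 0 * (exp (- c * w) / (1 - exp (- c * w)))) has_contour_integral (r + A 0 * 0)) ?bot"
    by (intro has_contour_integral_add has_contour_integral_lmul int_H int_Eb) (use d' in auto)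
  then have "((\<lambda>w. A w * (exp (- c * w) / (1 - exp (- c * w)))) has_contour_integral (r + A 0 * 0)) ?bot"
  proof (rule has_contour_integral_eq)
    fix w assume "w \<in> path_image ?bot"
    then have w: "w \<in> closed_segment (l (- d')) (l (- d') + of_real h)" by simp
    have w0: "w \<noteq> 0" "E w \<noteq> 1" "E w \<noteq> 0"
      using seg[OF w] d' bot_q[OF w] q by (auto simp: E_def exp_minus)
    have "exp (- c * w) / (1 - exp (- c * w)) = 1 / (E w - 1)"
      using w0 by (simp add: E_def exp_minus divide_simps)
    then show "H w + A 0 * (exp (- c * w) / (1 - exp (- c * w))) = A w * (exp (- c * w) / (1 - exp (- c * w)))"
      using w0 by (simp add: H_eq diff_divide_distrib)
  qed
  then have "norm (r + A 0 * 0) \<le> (M * (q / (1 - q))) * norm (l (- d') + of_real h - l (- d'))"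
  proof (rule has_contour_integral_bound_linepath)
    fix w assume w: "w \<in> closed_segment (l (- d')) (l (- d') + of_real h)"
    show "norm (A w * (exp (- c * w) / (1 - exp (- c * w)))) \<le> M * (q / (1 - q))"
      unfolding norm_mult using M[of w] seg[OF w] d' M0 norm_exp_neg_ratio_le[OF bot_q[OF w] q(2)]
      by (intro mult_mono) auto
  qed (use M0 q in auto)
  moreover have "norm (a - of_real h * A 0) \<le> norm (- (r + a - of_real h * A 0 - A 0 * 0)) + norm (r + A 0 * 0)"
    using norm_triangle_ineq4[of "- (r + a - of_real h * A 0)" "-r"] norm_minus_commute[of a "of_real h * A 0"]
    by simp
  ultimately have "norm (a - of_real h * A 0) \<le> M * (q / (1 - q)) * h + M * (q / (1 - q)) * h"
    using h by (simp only: add_diff_cancel_left' norm_of_real abs_of_pos)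
  then show ?thesis
    unfolding a_def q_def by (simp only: mult_ac mult_2 distrib_left)
qed

lemma trapezoidal_error_periodic:
  fixes \<Phi> :: "complex \<Rightarrow> complex" and L d d' M :: real and N :: nat
  assumes \<Phi>: "\<Phi> holomorphic_on strip d"
    and per: "\<And>w. w \<in> strip d \<Longrightarrow> \<Phi> (w + of_real L) = \<Phi> w"
    and L: "0 < L" and N: "1 \<le> N" and d': "0 < d'" "d' < d"
    and M: "\<And>w. \<bar>Im w\<bar> = d' \<Longrightarrow> norm (\<Phi> w) \<le> M"
  shows "norm (contour_integral (linepath 0 (of_real L)) \<Phi>
            - of_real (L / N) * (\<Sum>k<N. \<Phi> (of_real (real k * (L / N))))) \<le>
           2 * L * M * (exp (- 2 * pi * d' * N / L) / (1 - exp (- 2 * pi * d' * N / L)))"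
proof -
  define h where "h = L / N"
  have h: "0 < h" and Nh: "N * h = L" using L N by (auto simp: h_def)
  obtain P where P: "\<And>w. w \<in> strip d \<Longrightarrow> (P has_field_derivative \<Phi> w) (at w)"
    using holomorphic_primitive_convex_open[OF \<Phi> open_strip convex_strip] by blast
  \<comment> \<open>Averaging over the nodes turns \<open>\<Phi>\<close> into an \<open>h\<close>-periodic function, and the rule into a
    one-point rule.\<close>
  define avg where "avg = (\<lambda>(F::complex \<Rightarrow> complex) w. (\<Sum>k<N. F (w + of_real (k * h))) / N)"
  \<comment> \<open>A shift by \<open>h\<close> moves each node to the next one, so only the first
    and the last term survive. The correction vanishes for the periodic \<open>\<Phi>\<close>; for
    the primitive \<open>P\<close> at \<open>0\<close> it is the integral of \<open>\<Phi>\<close>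
    over the full period divided by \<open>N\<close>.\<close>
  have shift: "avg F (w + of_real h) = avg F w + (F (w + of_real L) - F w) / N" for F w
  proof -
    have "(\<Sum>k<N. F (w + of_real h + of_real (k * h))) = (\<Sum>k<N. F (w + of_real (Suc k * h)))"
      by (intro sum.cong) (simp_all add: algebra_simps)
    also have "\<dots> = (\<Sum>k<N. F (w + of_real (k * h))) + F (w + of_real (N * h)) - F w"
      using sum.lessThan_Suc_shift[of "\<lambda>k. F (w + of_real (k * h))" N]
        sum.lessThan_Suc[of "\<lambda>k. F (w + of_real (k * h))" N]
      by (simp add: eq_diff_eq add.commute del: sum.lessThan_Suc)
    also note Nh
    finally show ?thesis by (simp add: avg_def diff_divide_distrib add_divide_distrib)
  qed
  have est: "norm ((avg P (of_real h) - avg P 0) - of_real h * avg \<Phi> 0) \<le>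
         2 * h * M * (exp (- 2 * pi * d' / h) / (1 - exp (- 2 * pi * d' / h)))"
  proof (rule one_point_error_periodic[OF _ _ _ h d'])
    show "avg \<Phi> holomorphic_on strip d"
      unfolding avg_def
      using N by (intro holomorphic_on_divide holomorphic_on_sum holomorphic_on_const
          holomorphic_on_strip_translate \<Phi>) auto
    show "avg \<Phi> (w + of_real h) = avg \<Phi> w" if "w \<in> strip d" for w
      using shift[of \<Phi> w] per[OF that] by simp
    show "(avg P has_field_derivative avg \<Phi> w) (at w)" if "w \<in> strip d" for w
    proof -
      have "((\<lambda>w. P (w + of_real x)) has_field_derivative \<Phi> (w + of_real x)) (at w)" for x :: real
        using DERIV_shift P that by (metis add_of_real_in_strip)
      then show ?thesis
        unfolding avg_def by (intro DERIV_cdivide DERIV_sum) blast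
    qed
    show "norm (avg \<Phi> w) \<le> M" if "\<bar>Im w\<bar> = d'" for w
    proof -
      have "norm (\<Sum>k<N. \<Phi> (w + of_real (k * h))) \<le> (\<Sum>k<N. M)"
        by (intro order_trans[OF norm_sum] sum_mono M) (use that in auto)
      then have "norm (\<Sum>k<N. \<Phi> (w + of_real (k * h))) \<le> N * M"
        by (simp only: sum_constant card_lessThan)
      then show ?thesis
        unfolding avg_def norm_divide norm_of_nat
        using N by (simp only: pos_divide_le_eq[of "real N"] mult.commute)
    qed
  qed
  have avg_P: "avg P (of_real h) - avg P 0 = (P (of_real L) - P 0) / N"
    using shift[of P 0] by simp
  have avg_0: "of_real h * avg \<Phi> 0 = of_real (L / N) * (\<Sum>k<N. \<Phi> (of_real (real k * (L / N)))) / N"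
    by (simp add: avg_def h_def)
  have int: "contour_integral (linepath 0 (of_real L)) \<Phi> = P (of_real L) - P 0"
  proof -
    have "closed_segment 0 (of_real L) \<subseteq> strip d"
      using d' by (intro closed_segment_subset convex_strip) (auto simp: strip_def)
    then show ?thesis
      using has_contour_integral_linepath_primitive[OF P] by (intro contour_integral_unique)
  qed
  define \<Delta> where "\<Delta> = contour_integral (linepath 0 (of_real L)) \<Phi>
            - of_real (L / N) * (\<Sum>k<N. \<Phi> (of_real (real k * (L / N))))"
  define R where "R = exp (- 2 * pi * d' / h) / (1 - exp (- 2 * pi * d' / h))"
  \<comment> \<open>The one-point error of the average is the trapezoidal error divided by
    \<open>N\<close>; multiplying back turns \<open>h\<close> into \<open>N * h = L\<close>.\<close>
  have "norm (\<Delta> / of_nat N) \<le> 2 * h * M * R"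
    using est unfolding avg_P avg_0 R_def \<Delta>_def int diff_divide_distrib .
  then have "norm \<Delta> \<le> (2 * h * M * R) * real N"
    using N unfolding norm_divide norm_of_nat by (subst (asm) pos_divide_le_eq) auto
  then have "norm \<Delta> \<le> 2 * (N * h) * M * R"
    by (simp only: mult_ac)
  moreover have "- 2 * pi * d' / h = - 2 * pi * d' * N / L"
    by (simp add: h_def)
  ultimately show ?thesis
    unfolding \<Delta>_def R_def Nh by (simp only:)
qed

subsection \<open>The function \<open>\<Psi>\<^sub>\<alpha>\<close>\<close>

lemma slit_plane_nonzero:
  assumes "w \<in> slit_plane" "0 \<le> x" "x \<le> (1::real)"
  shows "1 - w * of_real x \<noteq> 0"
proof
  assume eq: "1 - w * of_real x = 0"
  then have "x \<noteq> 0" by auto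
  with eq have "w = of_real (1 / x)" by (simp add: field_simps)
  moreover have "1 / x \<in> {1..}" using assms \<open>x \<noteq> 0\<close> by simp
  ultimately show False using assms(1) unfolding slit_plane_def by blast
qed

text \<open>Differentiation under the integral sign, carried out on small balls because these are
  convex while the slit plane is not. The denominator cannot vanish:
  \<open>w * of_real (r t) = 1\<close> would force \<open>w\<close> to be real and at least
  1.\<close>

lemma holomorphic_Cauchy_kernel_integral:
  fixes r :: "real \<Rightarrow> real"
  assumes r: "continuous_on {0..1} r" "\<And>t. t \<in> {0..1} \<Longrightarrow> r t \<in> {0..1}"
  shows "(\<lambda>w. integral {0..1} (\<lambda>t. 1 / (1 - w * of_real (r t)))) holomorphic_on slit_plane"
proof -
  have "\<exists>e>0. (\<lambda>w. integral {0..1} (\<lambda>t. 1 / (1 - w * of_real (r t)))) holomorphic_on ball z e"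
    if z: "z \<in> slit_plane" for z
  proof -
    obtain e where e: "e > 0" "ball z e \<subseteq> slit_plane"
      using z open_slit_plane openE by blast
    have nz: "1 - w * of_real (r t) \<noteq> 0" if "w \<in> ball z e" "t \<in> {0..1}" for w t
      using slit_plane_nonzero[of w "r t"] e(2) that r(2)[of t] by auto
    have "(\<lambda>w. integral (cbox 0 1) (\<lambda>t. 1 / (1 - w * of_real (r t)))) holomorphic_on ball z e"
    proof (rule leibniz_rule_holomorphic[where fx = "\<lambda>w t. of_real (r t) / (1 - w * of_real (r t))\<^sup>2"])
      show "((\<lambda>w. 1 / (1 - w * of_real (r t))) has_field_derivative
              of_real (r t) / (1 - w * of_real (r t))\<^sup>2) (at w within ball z e)"
        if "w \<in> ball z e" "t \<in> cbox 0 1" for w t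
        using nz[of w t] that by (auto intro!: derivative_eq_intros simp: power2_eq_square)
      show "(\<lambda>t. 1 / (1 - w * of_real (r t))) integrable_on cbox 0 1" if "w \<in> ball z e" for w
        using nz[OF that] by (intro integrable_continuous continuous_intros) (auto intro: r)
      have "continuous_on (ball z e \<times> cbox 0 1) (\<lambda>x. r (snd x))"
        by (rule continuous_on_compose2[OF r(1)]) (auto intro!: continuous_intros)
      then show "continuous_on (ball z e \<times> cbox 0 1) (\<lambda>(w, t). of_real (r t) / (1 - w * of_real (r t))\<^sup>2)"
        using nz by (auto simp: case_prod_unfold intro!: continuous_intros)
    qed simp
    with e(1) show ?thesis by auto
  qed
  then show ?thesis
    using open_slit_plane analytic_on_open unfolding analytic_on_def by blast
qed

text \<open>The factor \<open>pochhammer 1 k\<close> cancels \<open>fact k\<close>. Splitting off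
  the first or the last factor of \<open>pochhammer a (Suc k)\<close> gives the remaining
  ratio.\<close>

lemma hypergeom_coeff:
  fixes a :: real
  assumes "0 < a"
  shows "pochhammer (of_real a) k * pochhammer 1 k / (pochhammer (of_real a + 1) k * fact k)
           = (of_real (a / (a + real k)) :: complex)"
proof -
  have "pochhammer a (Suc k) = a * pochhammer (a + 1) k" "pochhammer a (Suc k) = (a + k) * pochhammer a k"
    by (rule pochhammer_rec pochhammer_rec')+
  then have "pochhammer a k / pochhammer (a + 1) k = a / (a + k)"
    using assms pochhammer_pos[of "a + 1" k] by (simp add: field_simps)
  moreover have "pochhammer (of_real a) k / pochhammer (of_real a + 1) k
                   = (of_real (pochhammer a k / pochhammer (a + 1) k) :: complex)"
    using pochhammer_of_real[of a k, where ?'a = complex] pochhammer_of_real[of "a + 1" k, where ?'a = complex]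
    by simp
  ultimately show ?thesis
    by (simp add: pochhammer_fact[symmetric])
qed

lemma continuous_on_powr_unit:
  "0 < a \<Longrightarrow> continuous_on {0..1} (\<lambda>t::real. t powr (1 / a))"
  by (intro continuous_on_powr' continuous_intros) auto

lemma powr_unit_interval:
  "0 < a \<Longrightarrow> t \<in> {0..1::real} \<Longrightarrow> t powr (1 / a) \<in> {0..1}"
  by (auto intro: powr_le1)

lemma of_real_in_unit_segment:
  assumes "0 \<le> x" "x \<le> 1"
  shows "of_real x \<in> closed_segment 0 (1::complex)"
  using assms by (auto simp: in_segment scaleR_conv_of_real intro!: exI[of _ x])

text \<open>These moments are exactly the coefficients found in \<open>hypergeom_coeff\<close>,
  which is why the exponent \<open>1 / a\<close> is used.\<close>

lemma has_integral_powr_power: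
  fixes a :: real
  assumes "0 < a"
  shows "((\<lambda>t. of_real ((t powr (1 / a)) ^ k)) has_integral (of_real (a / (a + real k)) :: complex)) {0..1}"
proof -
  have "((\<lambda>t. t powr (k / a)) has_integral (1 powr (k / a + 1) / (k / a + 1))) {0..1::real}"
    using assms by (intro has_integral_powr_from_0) (auto intro: less_le_trans[of _ 0])
  moreover have "1 powr (k / a + 1) / (k / a + 1) = a / (a + real k)"
    using assms by (simp add: field_simps)
  ultimately have "((\<lambda>t. t powr (k / a)) has_integral (a / (a + real k))) {0..1::real}"
    by simp
  \<comment> \<open>The point \<open>0\<close> is excepted because of \<open>k = 0\<close>: there
    \<open>0 powr 0 = 0\<close>, whereas the zeroth power is \<open>1\<close>.\<close>
  then have "((\<lambda>t. (t powr (1 / a)) ^ k) has_integral (a / (a + real k))) {0..1::real}"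
    by (rule has_integral_spike_finite[of "{0}", rotated 2])
       (auto simp: powr_powr simp flip: powr_realpow)
  then show ?thesis
    by (rule has_integral_of_real)
qed

text \<open>For \<open>norm w < 1\<close> the kernel is a geometric series dominated by
  \<open>norm w ^ k\<close> uniformly in \<open>t\<close>, so it may be integrated term by term; the
  moments then give the hypergeometric series. In particular a continuation exists, so the choice in
  \<open>hypergeom\<close> is meaningful for these parameters.\<close>

lemma hypergeom_continuation_integral:
  fixes a :: real
  assumes a: "0 < a"
  shows "hypergeom_continuation (of_real a) 1 (of_real a + 1)
           (\<lambda>w. integral {0..1} (\<lambda>t. 1 / (1 - w * of_real (t powr (1 / a)))))"
  unfolding hypergeom_continuation_def
proof (intro conjI ballI)
  show "(\<lambda>w. integral {0..1} (\<lambda>t. 1 / (1 - w * of_real (t powr (1 / a))))) holomorphic_on slit_plane"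
    by (intro holomorphic_Cauchy_kernel_integral continuous_on_powr_unit powr_unit_interval a)
next
  fix w :: complex assume "w \<in> ball 0 1"
  then have w: "norm w < 1" by simp
  let ?f = "\<lambda>k t. (w * of_real (t powr (1 / a))) ^ k"
  have le: "norm (w * of_real (t powr (1 / a))) \<le> norm w" if "t \<in> {0..1}" for t
    using powr_unit_interval[OF a that] by (auto simp: norm_mult intro: mult_left_le)
  have "uniform_limit {0..1} (\<lambda>m t. \<Sum>k<m. ?f k t) (\<lambda>t. \<Sum>k. ?f k t) sequentially"
  proof (rule Weierstrass_m_test)
    show "norm (?f k t) \<le> norm w ^ k" if "t \<in> {0..1}" for k t
      unfolding norm_power using le[OF that] by (intro power_mono) auto
  qed (use w in \<open>simp add: summable_geometric\<close>)
  then obtain I J where IJ: "\<And>m. ((\<lambda>t. \<Sum>k<m. ?f k t) has_integral I m) {0..1}"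
      "((\<lambda>t. \<Sum>k. ?f k t) has_integral J) {0..1}" "I \<longlonglongrightarrow> J"
    by (rule uniform_limit_integral)
       (auto intro!: continuous_intros continuous_on_powr_unit[OF a])
  have "I = (\<lambda>m. \<Sum>k<m. w ^ k * of_real (a / (a + real k)))"
  proof (rule ext, rule has_integral_unique[OF IJ(1)])
    fix m
    show "((\<lambda>t. \<Sum>k<m. ?f k t) has_integral (\<Sum>k<m. w ^ k * of_real (a / (a + real k)))) {0..1}"
      unfolding power_mult_distrib of_real_power[symmetric]
      by (intro has_integral_sum has_integral_mult_right has_integral_powr_power a) auto
  qed
  moreover have "integral {0..1} (\<lambda>t. 1 / (1 - w * of_real (t powr (1 / a)))) = J"
  proof (rule integral_unique, rule has_integral_eq[OF _ IJ(2)])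
    show "(\<Sum>k. ?f k t) = 1 / (1 - w * of_real (t powr (1 / a)))" if "t \<in> {0..1}" for t
      using le[OF that] w by (intro suminf_geometric) auto
  qed
  ultimately show "(\<lambda>k. pochhammer (of_real a) k * pochhammer 1 k /
            (pochhammer (of_real a + 1) k * fact k) * w ^ k)
          sums integral {0..1} (\<lambda>t. 1 / (1 - w * of_real (t powr (1 / a))))"
    using IJ(3) unfolding sums_def hypergeom_coeff[OF a] by (simp only: mult.commute)
qed

lemma inverse_in_slit_plane:
  assumes "z \<notin> closed_segment 0 1"
  shows "inverse z \<in> slit_plane"
proof (rule ccontr)
  assume "inverse z \<notin> slit_plane"
  then obtain x :: real where x: "1 \<le> x" "inverse z = of_real x"
    by (auto simp: slit_plane_def)
  then have "z = of_real (inverse x)"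
    by (metis inverse_inverse_eq of_real_inverse)
  moreover have "0 \<le> inverse x" "inverse x \<le> 1"
    using x by (auto simp: inverse_le_1_iff)
  ultimately show False
    using assms by (auto simp: in_segment scaleR_conv_of_real)
qed

text \<open>Existence of a continuation makes the chosen function one, and uniqueness on the slit
  plane identifies it with the integral.\<close>

lemma hypergeom_eq_integral:
  fixes a :: real
  assumes a: "0 < a" and w: "w \<in> slit_plane"
  shows "hypergeom (of_real a) 1 (of_real a + 1) w
           = integral {0..1} (\<lambda>t. 1 / (1 - w * of_real (t powr (1 / a))))"
proof -
  have "hypergeom_continuation (of_real a) 1 (of_real a + 1) (hypergeom (of_real a) 1 (of_real a + 1))"
    unfolding hypergeom_def using someI[of "hypergeom_continuation (of_real a) 1 (of_real a + 1)"]
      hypergeom_continuation_integral[OF a] by blast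
  then show ?thesis
    using hypergeom_continuation_unique hypergeom_continuation_integral[OF a] w by blast
qed

lemma Psi_eq_integral:
  assumes \<alpha>: "0 < \<alpha>" and z: "z \<notin> closed_segment 0 1"
  shows "Psi \<alpha> z = integral {0..1} (\<lambda>t. 1 / (z - of_real (t powr (1 / \<alpha>)))) / of_real \<alpha>"
proof -
  have z0: "z \<noteq> 0" using z by auto
  have "Psi \<alpha> z = inverse z * integral {0..1} (\<lambda>t. 1 / (1 - inverse z * of_real (t powr (1 / \<alpha>)))) / of_real \<alpha>"
    unfolding Psi_def hypergeom_eq_integral[OF \<alpha> inverse_in_slit_plane[OF z]]
    by (simp add: divide_inverse mult_ac)
  also have "inverse z * integral {0..1} (\<lambda>t. 1 / (1 - inverse z * of_real (t powr (1 / \<alpha>))))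
     = integral {0..1} (\<lambda>t. inverse z * (1 / (1 - inverse z * of_real (t powr (1 / \<alpha>)))))"
    by (rule integral_mult_right[symmetric])
  also have "\<dots> = integral {0..1} (\<lambda>t. 1 / (z - of_real (t powr (1 / \<alpha>))))"
  proof (rule integral_cong)
    fix t
    have "z - of_real (t powr (1 / \<alpha>)) = z * (1 - inverse z * of_real (t powr (1 / \<alpha>)))"
      using z0 by (simp add: right_diff_distrib)
    then show "inverse z * (1 / (1 - inverse z * of_real (t powr (1 / \<alpha>)))) = 1 / (z - of_real (t powr (1 / \<alpha>)))"
      by (simp add: divide_inverse inverse_mult_distrib)
  qed
  finally show ?thesis .
qed

lemma holomorphic_Psi:
  assumes \<alpha>: "0 < \<alpha>"
  shows "Psi \<alpha> holomorphic_on - closed_segment 0 1"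
proof -
  have inv: "(\<lambda>z. inverse z) holomorphic_on - closed_segment 0 (1::complex)"
    by (rule holomorphic_on_inverse[OF holomorphic_on_ident]) auto
  have "hypergeom (of_real \<alpha>) 1 (of_real \<alpha> + 1) holomorphic_on slit_plane"
    by (rule holomorphic_transform[OF _ hypergeom_eq_integral[OF \<alpha>, symmetric]])
       (rule hypergeom_continuation_integral[OF \<alpha>, unfolded hypergeom_continuation_def, THEN conjunct1])
  then have "(hypergeom (of_real \<alpha>) 1 (of_real \<alpha> + 1) \<circ> inverse) holomorphic_on - closed_segment 0 1"
    by (rule holomorphic_on_compose_gen[rotated])
       (use inverse_in_slit_plane inv in auto)
  then have hyp: "(\<lambda>z. hypergeom (of_real \<alpha>) 1 (of_real \<alpha> + 1) (inverse z)) holomorphic_on - closed_segment 0 1"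
    by (simp only: o_def)
  show ?thesis
    unfolding Psi_def[abs_def] by (intro holomorphic_on_mult holomorphic_on_const inv hyp)
qed

subsection \<open>The finite part integral\<close>

text \<open>Away from \<open>0\<close> the remainder \<open>g\<close> is a quotient of holomorphic
  functions. Near \<open>0\<close> it is the power series of \<open>f\<close> with the coefficients
  shifted by \<open>n\<close>, which also dictates the value \<open>c n\<close> at
  \<open>0\<close>.\<close>

lemma Taylor_remainder_holomorphic:
  assumes f: "f holomorphic_on D" and D: "open D" "0 \<in> D"
  obtains g where "g holomorphic_on D"
    "\<And>z. z \<in> D \<Longrightarrow> f z = (\<Sum>k<n. (deriv ^^ k) f 0 / fact k * z ^ k) + z ^ n * g z"
proof -
  define c where "c = (\<lambda>k. (deriv ^^ k) f 0 / fact k)"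
  define g where "g = (\<lambda>z. if z = 0 then c n else (f z - (\<Sum>k<n. c k * z ^ k)) / z ^ n)"
  obtain e where e: "0 < e" "ball 0 e \<subseteq> D"
    using D openE by blast
  have fsums: "(\<lambda>k. c k * z ^ k) sums f z" if "z \<in> ball 0 e" for z
    using holomorphic_power_series[OF holomorphic_on_subset[OF f e(2)] that] by (simp add: c_def)
  have "(\<lambda>k. c (k + n) * (z - 0) ^ k) sums g z" if z: "z \<in> ball 0 e" for z
  proof (cases "z = 0")
    case True
    then show ?thesis
      using powser_sums_zero[of "\<lambda>k. c (k + n)"] by (simp add: g_def)
  next
    case False
    have "(\<lambda>k. c (k + n) * z ^ (k + n)) sums (f z - (\<Sum>k<n. c k * z ^ k))"
      using fsums[OF z] by (rule sums_split_initial_segment)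
    then have "(\<lambda>k. c (k + n) * z ^ (k + n) / z ^ n) sums g z"
      unfolding g_def using False by (simp only: if_False sums_divide)
    then show ?thesis
      using False by (simp add: power_add)
  qed
  then have "g holomorphic_on ball 0 e"
    by (rule power_series_holomorphic)
  moreover have "g holomorphic_on D - {0}"
  proof (rule holomorphic_transform)
    show "(\<lambda>z. (f z - (\<Sum>k<n. c k * z ^ k)) / z ^ n) holomorphic_on D - {0}"
      using f by (intro holomorphic_intros) (auto intro: holomorphic_on_subset)
  qed (auto simp: g_def)
  ultimately have "g holomorphic_on ball 0 e \<union> (D - {0})"
    using D by (intro holomorphic_on_Un open_delete) auto
  moreover have "ball 0 e \<union> (D - {0}) = D"
    using e D by auto
  ultimately have "g holomorphic_on D" by simp
  moreover have "f z = (\<Sum>k<n. c k * z ^ k) + z ^ n * g z" if "z \<in> D" for z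
  proof (cases "z = 0")
    case True
    have "f 0 = c 0" by (simp add: c_def)
    \<comment> \<open>For \<open>n = 0\<close> the sum is empty and \<open>g 0 = c 0\<close>
      supplies the value; for \<open>n > 0\<close> the power \<open>0 ^ n\<close> removes
      \<open>g\<close> and only the term \<open>k = 0\<close> remains.\<close>
    then show ?thesis
      using True by (cases n) (auto simp: g_def sum.lessThan_Suc_shift simp del: sum.lessThan_Suc)
  qed (simp add: g_def)
  ultimately show ?thesis
    using that unfolding c_def by blast
qed

text \<open>Integrating the Taylor terms gives powers whose values at \<epsilon> cancel the
  subtracted sum and whose values at 1 form the sum on the right. The remainder carries the
  integrable weight \<open>x powr (\<alpha> - 1)\<close>, and the substitution
  \<open>t = x powr \<alpha>\<close> removes this weight up to the factor
  \<open>1 / \<alpha>\<close>.\<close>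

lemma finite_part_integral_eq:
  fixes f g :: "complex \<Rightarrow> complex" and \<alpha> :: real
  assumes \<alpha>: "0 < \<alpha>" "\<alpha> < 1"
    and g: "continuous_on (closed_segment 0 1) g"
    and fg: "\<And>z. z \<in> closed_segment 0 1 \<Longrightarrow>
      f z = (\<Sum>k<n. (deriv ^^ k) f 0 / fact k * z ^ k) + z ^ n * g z"
  shows "finite_part_integral n \<alpha> f =
           integral {0..1} (\<lambda>t. g (of_real (t powr (1 / \<alpha>)))) / of_real \<alpha>
           + (\<Sum>k<n. (deriv ^^ k) f 0 / of_real (fact k * (\<alpha> - real n + real k)))"
proof -
  define c where "c = (\<lambda>k. (deriv ^^ k) f 0 / fact k)"
  define b where "b = (\<lambda>k. \<alpha> - real n + real k)"
  define r where "r = (\<lambda>t::real. t powr (1 / \<alpha>))"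
  \<comment> \<open>\<open>Q (x powr \<alpha>) / \<alpha>\<close> is a primitive of \<open>x powr (\<alpha> - 1) * g x\<close>.\<close>
  define Q where "Q = (\<lambda>s. integral {0..s} (\<lambda>t. g (of_real (r t))))"
  define S where "S = (\<Sum>k<n. c k / of_real (b k))"
  \<comment> \<open>In fact \<open>b k \<le> \<alpha> - 1 < 0\<close> for \<open>k < n\<close>, so
    every Taylor term diverges as a pure power and no logarithm occurs.\<close>
  have b0: "b k \<noteq> 0" if "k < n" for k
    using that \<alpha> by (auto simp: b_def)
  have fg': "f (of_real x) = (\<Sum>k<n. c k * of_real x ^ k) + of_real x ^ n * g (of_real x)"
    if "0 \<le> x" "x \<le> 1" for x :: real
    using fg[OF of_real_in_unit_segment[OF that]] unfolding c_def .
  have r: "continuous_on {0..1} r" "\<And>t. t \<in> {0..1} \<Longrightarrow> r t \<in> {0..1}"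
    unfolding r_def using continuous_on_powr_unit powr_unit_interval \<alpha> by auto
  have cont: "continuous_on {0..1} (\<lambda>t. g (of_real (r t)))"
    by (rule continuous_on_compose2[OF g])
       (use r of_real_in_unit_segment in \<open>auto intro!: continuous_intros\<close>)
  \<comment> \<open>An exact identity for each \<epsilon> in (0,1): all divergent terms have
    cancelled, and the limit reduces to the continuity of \<open>Q\<close> at
    \<open>0\<close>.\<close>
  have bracket: "integral {\<epsilon>..1} (\<lambda>x. of_real (x powr (\<alpha> - 1 - real n)) * f (of_real x))
         - (\<Sum>k<n. of_real (\<epsilon> powr (\<alpha> - real n + real k) / (fact k * (real n - real k - \<alpha>))) * (deriv ^^ k) f 0)
       = (Q 1 - Q (\<epsilon> powr \<alpha>)) / of_real \<alpha> + S"
    if \<epsilon>: "0 < \<epsilon>" "\<epsilon> < 1" for \<epsilon> :: real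
  proof -
    have "((\<lambda>x. c k * of_real (x powr (b k - 1))) has_integral
        (c k * of_real (1 powr b k / b k - \<epsilon> powr b k / b k))) {\<epsilon>..1}" if "k < n" for k
    proof (intro has_integral_mult_right has_integral_of_real fundamental_theorem_of_calculus)
      show "((\<lambda>x. x powr b k / b k) has_vector_derivative x powr (b k - 1)) (at x within {\<epsilon>..1})"
        if "x \<in> {\<epsilon>..1}" for x
        unfolding has_real_derivative_iff_has_vector_derivative[symmetric]
        using that \<epsilon> b0[OF \<open>k < n\<close>] by (auto intro!: derivative_eq_intros)
    qed (use \<epsilon> in simp)
    then have int_T: "((\<lambda>x. \<Sum>k<n. c k * of_real (x powr (b k - 1))) has_integral
        (\<Sum>k<n. c k * of_real (1 powr b k / b k - \<epsilon> powr b k / b k))) {\<epsilon>..1}"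
      by (intro has_integral_sum) auto
    have int_g: "((\<lambda>x. of_real (x powr (\<alpha> - 1)) * g (of_real x)) has_integral
        (Q (1 powr \<alpha>) / of_real \<alpha> - Q (\<epsilon> powr \<alpha>) / of_real \<alpha>)) {\<epsilon>..1}"
    proof (rule fundamental_theorem_of_calculus)
      fix x assume x: "x \<in> {\<epsilon>..1}"
      have img: "(\<lambda>x. x powr \<alpha>) ` {\<epsilon>..1} \<subseteq> {0..1}"
        using \<epsilon> \<alpha> by (auto intro!: powr_le1)
      have 1: "((\<lambda>x. x powr \<alpha>) has_vector_derivative (\<alpha> * x powr (\<alpha> - 1))) (at x within {\<epsilon>..1})"
        unfolding has_real_derivative_iff_has_vector_derivative[symmetric]
        using x \<epsilon> by (auto intro!: derivative_eq_intros)
      \<comment> \<open>Since \<open>r\<close> inverts \<open>x powr \<alpha>\<close> for positive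
        \<open>x\<close>, the derivative of \<open>Q\<close> at \<open>x powr \<alpha>\<close> is
        \<open>g x\<close>. It is then restricted to the image of the interval, as the chain rule
        within a set demands.\<close>
      have "(Q has_vector_derivative g (of_real (r (x powr \<alpha>)))) (at (x powr \<alpha>) within {0..1})"
        unfolding Q_def using subsetD[OF img imageI[OF x]] by (intro integral_has_vector_derivative cont)
      moreover have "r (x powr \<alpha>) = x"
        using x \<epsilon> \<alpha> by (simp add: r_def powr_powr)
      ultimately have 2: "(Q has_vector_derivative g (of_real x)) (at (x powr \<alpha>) within (\<lambda>x. x powr \<alpha>) ` {\<epsilon>..1})"
        using has_vector_derivative_within_subset img by metis
      have "((\<lambda>x. Q (x powr \<alpha>)) has_vector_derivative (\<alpha> * x powr (\<alpha> - 1)) *\<^sub>R g (of_real x)) (at x within {\<epsilon>..1})"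
        using vector_diff_chain_within[OF 1 2] by (simp add: o_def)
      then have "((\<lambda>x. Q (x powr \<alpha>) / of_real \<alpha>) has_vector_derivative
          ((\<alpha> * x powr (\<alpha> - 1)) *\<^sub>R g (of_real x)) / of_real \<alpha>) (at x within {\<epsilon>..1})"
        by (rule has_vector_derivative_divide)
      then show "((\<lambda>x. Q (x powr \<alpha>) / of_real \<alpha>) has_vector_derivative
          of_real (x powr (\<alpha> - 1)) * g (of_real x)) (at x within {\<epsilon>..1})"
        using \<alpha> by (simp add: scaleR_conv_of_real)
    qed (use \<epsilon> in simp)
    have "((\<lambda>x. of_real (x powr (\<alpha> - 1 - real n)) * f (of_real x)) has_integral
        ((\<Sum>k<n. c k * of_real (1 powr b k / b k - \<epsilon> powr b k / b k)) +
         (Q (1 powr \<alpha>) / of_real \<alpha> - Q (\<epsilon> powr \<alpha>) / of_real \<alpha>))) {\<epsilon>..1}"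
    proof (rule has_integral_eq[OF _ has_integral_add[OF int_T int_g]])
      fix x assume x: "x \<in> {\<epsilon>..1}"
      then have x0: "0 < x" "x \<le> 1" using \<epsilon> by auto
      have pw: "x powr (\<alpha> - 1 - real n) * x ^ k = x powr (b k - 1)" for k
        using x0 by (simp add: b_def flip: powr_realpow powr_add) (simp add: algebra_simps)
      have "b n = \<alpha>" by (simp add: b_def)
      have "of_real (x powr (\<alpha> - 1 - real n)) * (c k * of_real x ^ k) = c k * of_real (x powr (b k - 1))" for k
        unfolding pw[symmetric] by simp
      moreover have "of_real (x powr (\<alpha> - 1 - real n)) * (of_real x ^ n * g (of_real x))
                      = of_real (x powr (\<alpha> - 1)) * g (of_real x)"
        using pw[of n] unfolding \<open>b n = \<alpha>\<close> by (simp add: mult.assoc[symmetric] flip: of_real_mult of_real_power)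
      ultimately show "(\<Sum>k<n. c k * of_real (x powr (b k - 1))) + of_real (x powr (\<alpha> - 1)) * g (of_real x)
          = of_real (x powr (\<alpha> - 1 - real n)) * f (of_real x)"
        unfolding fg'[OF less_imp_le[OF x0(1)] x0(2)] by (simp only: distrib_left sum_distrib_left)
    qed
    then have int: "integral {\<epsilon>..1} (\<lambda>x. of_real (x powr (\<alpha> - 1 - real n)) * f (of_real x)) =
        (\<Sum>k<n. c k * of_real (1 powr b k / b k - \<epsilon> powr b k / b k)) +
         (Q (1 powr \<alpha>) / of_real \<alpha> - Q (\<epsilon> powr \<alpha>) / of_real \<alpha>)"
      by (rule integral_unique)
    have "c k * of_real (1 powr b k / b k - \<epsilon> powr b k / b k)
        - of_real (\<epsilon> powr (\<alpha> - real n + real k) / (fact k * (real n - real k - \<alpha>))) * (deriv ^^ k) f 0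
        = c k / of_real (b k)" if "k < n" for k
    proof -
      have "real n - real k - \<alpha> = - b k" "\<alpha> - real n + real k = b k"
        by (simp_all add: b_def)
      then show ?thesis
        using b0[OF that] by (simp add: c_def field_simps)
    qed
    then have "(\<Sum>k<n. c k * of_real (1 powr b k / b k - \<epsilon> powr b k / b k)
        - of_real (\<epsilon> powr (\<alpha> - real n + real k) / (fact k * (real n - real k - \<alpha>))) * (deriv ^^ k) f 0) = S"
      unfolding S_def by (intro sum.cong) auto
    note sum_eq = this[unfolded sum_subtractf]
    have aux: "u - v = s \<Longrightarrow> u + x - v = x + s" for u v s x :: complex
      by (simp add: algebra_simps)
    show ?thesis
      unfolding int powr_one_eq_one diff_divide_distrib[of "Q 1"]
      by (rule aux[OF sum_eq[unfolded powr_one_eq_one]])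
  qed
  have "((\<lambda>\<epsilon>. (Q 1 - Q (\<epsilon> powr \<alpha>)) / of_real \<alpha> + S) \<longlongrightarrow> (Q 1 - 0) / of_real \<alpha> + S) (at_right 0)"
  proof (intro tendsto_intros)
    have "continuous_on {0..1} Q"
      unfolding Q_def by (intro indefinite_integral_continuous_1 integrable_continuous_real cont)
    then have "(Q \<longlongrightarrow> Q 0) (at 0 within {0..1})"
      by (simp add: continuous_on_def)
    moreover have "filterlim (\<lambda>\<epsilon>. \<epsilon> powr \<alpha>) (at 0 within {0..1}) (at_right 0)"
      unfolding filterlim_at
    proof
      show "\<forall>\<^sub>F \<epsilon> in at_right 0. \<epsilon> powr \<alpha> \<in> {0..1} \<and> \<epsilon> powr \<alpha> \<noteq> 0"
        unfolding eventually_at_right_field using \<alpha> by (intro exI[of _ 1]) (auto intro: powr_le1)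
      show "((\<lambda>\<epsilon>. \<epsilon> powr \<alpha>) \<longlongrightarrow> 0) (at_right 0)"
      proof -
        have "((\<lambda>\<epsilon>::real. \<epsilon> powr \<alpha>) \<longlongrightarrow> 0 powr \<alpha>) (at_right 0)"
          using \<alpha> by (intro tendsto_powr') (auto intro!: eventually_at_rightI[of 0 1] tendsto_ident_at)
        then show ?thesis by simp
      qed
    qed
    ultimately show "((\<lambda>\<epsilon>. Q (\<epsilon> powr \<alpha>)) \<longlongrightarrow> 0) (at_right 0)"
      using filterlim_compose[of Q "nhds (Q 0)"] by (fastforce simp: Q_def)
  qed (use \<alpha> in auto)
  then have "((\<lambda>\<epsilon>. integral {\<epsilon>..1} (\<lambda>x. of_real (x powr (\<alpha> - 1 - real n)) * f (of_real x))
         - (\<Sum>k<n. of_real (\<epsilon> powr (\<alpha> - real n + real k) / (fact k * (real n - real k - \<alpha>))) * (deriv ^^ k) f 0))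
       \<longlongrightarrow> (Q 1 - 0) / of_real \<alpha> + S) (at_right 0)"
  proof (rule Lim_transform_eventually)
    show "\<forall>\<^sub>F \<epsilon> in at_right 0. (Q 1 - Q (\<epsilon> powr \<alpha>)) / of_real \<alpha> + S =
        integral {\<epsilon>..1} (\<lambda>x. of_real (x powr (\<alpha> - 1 - real n)) * f (of_real x))
         - (\<Sum>k<n. of_real (\<epsilon> powr (\<alpha> - real n + real k) / (fact k * (real n - real k - \<alpha>))) * (deriv ^^ k) f 0)"
      using bracket by (intro eventually_at_rightI[of 0 1]) auto
  qed
  then have "finite_part_integral n \<alpha> f = (Q 1 - 0) / of_real \<alpha> + S"
    unfolding finite_part_integral_def by (rule tendsto_Lim[OF trivial_limit_at_right_real])
  then show ?thesis
    by (simp add: Q_def S_def r_def c_def b_def)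
qed

subsection \<open>The contour integral\<close>

text \<open>For nonzero \<open>x\<close>, partial fractions reduce
  \<open>1 / (z ^ Suc k * (z - x))\<close> to \<open>1 / (z ^ k * (z - x))\<close> and
  \<open>1 / z ^ Suc k\<close>. At \<open>k = 0\<close> their integrals cancel by the equality of
  the winding numbers; for \<open>k \<ge> 1\<close> both are \<open>0\<close>. For
  \<open>x = 0\<close> the integrand is a power of order at least 2 in \<open>1 / z\<close>, which
  has a primitive.\<close>

lemma has_contour_integral_recip_power_times:
  fixes x :: complex
  assumes \<gamma>: "valid_path \<gamma>" "pathfinish \<gamma> = pathstart \<gamma>"
    and nin: "0 \<notin> path_image \<gamma>" "x \<notin> path_image \<gamma>"
    and wn: "winding_number \<gamma> x = winding_number \<gamma> 0"
    and m: "1 \<le> m"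
  shows "((\<lambda>z. 1 / (z ^ m * (z - x))) has_contour_integral 0) \<gamma>"
proof -
  have pow: "((\<lambda>z. 1 / z ^ (Suc k)) has_contour_integral 0) \<gamma>" if k: "1 \<le> k" for k
  proof (rule Cauchy_theorem_primitive[OF _ \<gamma>(1) _ \<gamma>(2)])
    show "((\<lambda>z. - 1 / (of_nat k * z ^ k)) has_field_derivative 1 / z ^ Suc k) (at z within - {0})"
      if "z \<in> - {0}" for z :: complex
    proof -
      have "z ^ k = z * z ^ (k - 1)" using k by (simp add: power_eq_if)
      then show ?thesis
        using that k by (auto intro!: derivative_eq_intros simp: divide_simps)
    qed
  qed (use nin in auto)
  show ?thesis
  proof (cases "x = 0")
    case True
    then show ?thesis using pow[OF m] by (simp add: mult.commute)
  next
    case False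
    have step: "1 / x * (1 / (z ^ k * (z - x)) - 1 / z ^ Suc k) = 1 / (z ^ Suc k * (z - x))"
      if "z \<in> path_image \<gamma>" for z k
    proof -
      have "z \<noteq> 0" "z - x \<noteq> 0" using that nin by auto
      then show ?thesis using False by (simp add: divide_simps)
    qed
    have next_pow: "((\<lambda>z. 1 / (z ^ Suc k * (z - x))) has_contour_integral 1 / x * (u - v)) \<gamma>"
      if "((\<lambda>z. 1 / (z ^ k * (z - x))) has_contour_integral u) \<gamma>"
        "((\<lambda>z. 1 / z ^ Suc k) has_contour_integral v) \<gamma>" for k u v
      by (rule has_contour_integral_eq[OF has_contour_integral_lmul[OF has_contour_integral_diff[OF that]] step])
    from m show ?thesis
    proof (induction m rule: dec_induct)
      case base
      show ?case
        using next_pow[of 0] has_contour_integral_winding_number[OF \<gamma>(1) nin(1)]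
          has_contour_integral_winding_number[OF \<gamma>(1) nin(2)] wn by fastforce
    next
      case (step k)
      then show ?case using next_pow[of k 0 0] pow[of k] by simp
    qed
  qed
qed

text \<open>Division by \<open>z ^ n\<close> leaves each Taylor term with exponent
  \<open>n - k \<ge> 1\<close> in the denominator, so these terms integrate to \<open>0\<close>. The
  remainder yields \<open>g x\<close> by the global Cauchy formula, whose condition on the points
  outside \<open>D\<close> is the last winding number hypothesis.\<close>

lemma has_contour_integral_Taylor_remainder:
  fixes f g :: "complex \<Rightarrow> complex"
  assumes D: "open D" "x \<in> D"
    and g: "g holomorphic_on D"
    and fg: "\<And>z. z \<in> D \<Longrightarrow> f z = (\<Sum>k<n. c k * z ^ k) + z ^ n * g z"
    and \<gamma>: "valid_path \<gamma>" "pathfinish \<gamma> = pathstart \<gamma>" "path_image \<gamma> \<subseteq> D - {0, x}"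
    and wn: "winding_number \<gamma> 0 = 1" "winding_number \<gamma> x = 1"
      "\<And>z. z \<notin> D \<Longrightarrow> winding_number \<gamma> z = 0"
  shows "((\<lambda>z. f z / z ^ n / (z - x)) has_contour_integral (2 * pi * \<i> * g x)) \<gamma>"
proof -
  have "((\<lambda>z. g z / (z - x)) has_contour_integral (2 * pi * \<i> * winding_number \<gamma> x * g x)) \<gamma>"
    using D g \<gamma> wn by (intro Cauchy_integral_formula_global) auto
  moreover have "((\<lambda>z. \<Sum>k<n. c k * (1 / (z ^ (n - k) * (z - x)))) has_contour_integral (\<Sum>k<n. c k * 0)) \<gamma>"
    using \<gamma> wn by (intro has_contour_integral_sum has_contour_integral_lmul
        has_contour_integral_recip_power_times) auto
  ultimately have "((\<lambda>z. g z / (z - x) + (\<Sum>k<n. c k * (1 / (z ^ (n - k) * (z - x)))))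
      has_contour_integral (2 * pi * \<i> * winding_number \<gamma> x * g x + (\<Sum>k<n. c k * 0))) \<gamma>"
    by (rule has_contour_integral_add)
  then have "((\<lambda>z. f z / z ^ n / (z - x))
      has_contour_integral (2 * pi * \<i> * winding_number \<gamma> x * g x + (\<Sum>k<n. c k * 0))) \<gamma>"
  proof (rule has_contour_integral_eq)
    fix z assume "z \<in> path_image \<gamma>"
    then have z: "z \<in> D" "z \<noteq> 0" using \<gamma>(3) by auto
    have "c k * (1 / (z ^ (n - k) * (z - x))) = c k * z ^ k / z ^ n / (z - x)" if "k < n" for k
      using z that by (simp add: power_diff)
    then have "(\<Sum>k<n. c k * (1 / (z ^ (n - k) * (z - x)))) = (\<Sum>k<n. c k * z ^ k) / z ^ n / (z - x)"
      by (simp add: sum_divide_distrib)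
    then show "g z / (z - x) + (\<Sum>k<n. c k * (1 / (z ^ (n - k) * (z - x)))) = f z / z ^ n / (z - x)"
      unfolding fg[OF z(1)] using z(2) by (simp add: add_divide_distrib)
  qed
  then show ?thesis by (simp add: wn)
qed

lemma holomorphic_integrand:
  assumes "0 < \<alpha>" "\<phi> holomorphic_on S" "open S" "\<phi> ` S \<subseteq> - closed_segment 0 1"
    and "f analytic_on \<phi> ` S"
  shows "integrand n \<alpha> f \<phi> holomorphic_on S"
proof -
  have "\<phi> analytic_on S"
    using assms by (simp add: analytic_on_open)
  then have "(\<lambda>w. f (\<phi> w)) holomorphic_on S"
    using analytic_on_compose[of \<phi> S f] assms(5) by (simp add: o_def analytic_imp_holomorphic)
  moreover have "(\<lambda>w. Psi \<alpha> (\<phi> w)) holomorphic_on S"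
    using holomorphic_on_compose_gen[OF assms(2) holomorphic_Psi[OF assms(1)] assms(4)]
    by (simp add: o_def)
  moreover have "\<phi> w \<noteq> 0" if "w \<in> S" for w
    using that assms(4) by auto
  ultimately show ?thesis
    unfolding integrand_def[abs_def] using assms(2,3)
    by (intro holomorphic_on_mult holomorphic_on_power_int holomorphic_deriv) auto
qed

text \<open>With \<Psi> written as an integral over \<open>t\<close>, Fubini moves the contour
  integral inside. For fixed \<open>t\<close>, the substitution \<open>z = \<phi> w\<close> turns
  the inner integral into the one evaluated by \<open>cauchy\<close> at the point
  \<open>t powr (1 / \<alpha>)\<close>.\<close>

lemma contour_integral_integrand:
  fixes f g \<phi> :: "complex \<Rightarrow> complex"
  assumes \<alpha>: "0 < \<alpha>" and up: "0 < up" and S: "open S" "closed_segment 0 (of_real up) \<subseteq> S"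
    and \<phi>: "\<phi> holomorphic_on S" "\<phi> ` S \<subseteq> - closed_segment 0 1" "f analytic_on \<phi> ` S"
    and cauchy: "\<And>x. x \<in> closed_segment 0 1 \<Longrightarrow>
      ((\<lambda>z. f z / z ^ n / (z - x)) has_contour_integral (2 * pi * \<i> * g x)) (param_path \<phi> up)"
  shows "contour_integral (linepath 0 (of_real up)) (integrand n \<alpha> f \<phi>) =
           2 * pi * \<i> * (integral {0..1} (\<lambda>t. g (of_real (t powr (1 / \<alpha>)))) / of_real \<alpha>)"
proof -
  define r where "r = (\<lambda>t::real. t powr (1 / \<alpha>))"
  define G where "G = (\<lambda>w. deriv \<phi> w * (f (\<phi> w) / \<phi> w ^ n))"
  \<comment> \<open>The second argument is complex and enters through \<open>Re s\<close>, so that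
    the integral over \<open>t\<close> becomes a contour integral along \<open>linepath 0 1\<close>
    and the two contour integrals can be interchanged.\<close>
  define K where "K = (\<lambda>w s. G w / (\<phi> w - of_real (r (Re s))))"
  let ?lp = "linepath 0 (complex_of_real up)"
  have r: "continuous_on {0..1} r" "\<And>t. t \<in> {0..1} \<Longrightarrow> r t \<in> {0..1}"
    unfolding r_def using continuous_on_powr_unit powr_unit_interval \<alpha> by auto
  have seg: "of_real x \<in> closed_segment 0 (1::complex)" if "x \<in> {0..1}" for x :: real
    using that of_real_in_unit_segment by auto
  have Re_seg: "Re s \<in> {0..1}" if "s \<in> closed_segment 0 1" for s
    using that by (auto simp: in_segment)
  have nz: "\<phi> w \<noteq> 0" "\<phi> w - of_real (r t) \<noteq> 0" if "w \<in> S" "t \<in> {0..1}" for w t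
    using seg[OF r(2)[OF that(2)]] \<phi>(2) that(1) by auto
  have int_K: "contour_integral (linepath 0 1) (K w) = of_real \<alpha> * integrand n \<alpha> f \<phi> w" if w: "w \<in> S" for w
  proof -
    have "contour_integral (linepath 0 1) (K w) = integral {0..1} (\<lambda>t. G w * (1 / (\<phi> w - of_real (r t))))"
      by (simp add: contour_integral_linepath_Reals_eq K_def)
    also have "\<dots> = G w * integral {0..1} (\<lambda>t. 1 / (\<phi> w - of_real (r t)))"
      by (rule integral_mult_right)
    also have "integral {0..1} (\<lambda>t. 1 / (\<phi> w - of_real (r t))) = of_real \<alpha> * Psi \<alpha> (\<phi> w)"
      using Psi_eq_integral[OF \<alpha>, of "\<phi> w"] \<phi>(2) w \<alpha> by (auto simp: r_def)
    also have "\<phi> w \<noteq> 0" using nz[OF w, of 0] by simp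
    then have "G w * (of_real \<alpha> * Psi \<alpha> (\<phi> w)) = of_real \<alpha> * integrand n \<alpha> f \<phi> w"
      by (simp add: G_def integrand_def power_int_minus divide_inverse mult_ac)
    finally show ?thesis .
  qed
  have int_w: "contour_integral ?lp (\<lambda>w. K w (of_real t)) = 2 * pi * \<i> * g (of_real (r t))"
    if t: "t \<in> {0..1}" for t
  proof -
    have "contour_integral (param_path \<phi> up) (\<lambda>z. f z / z ^ n / (z - of_real (r t))) =
        contour_integral ?lp (\<lambda>w. deriv \<phi> w * (f (\<phi> w) / \<phi> w ^ n / (\<phi> w - of_real (r t))))"
      unfolding param_path_def using \<phi>(1) S
      by (intro contour_integral_comp_analyticW[where s = S]) (auto simp: analytic_on_open)
    then show ?thesis
      using contour_integral_unique[OF cauchy[OF seg[OF r(2)[OF t]]]] by (simp add: K_def G_def)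
  qed
  have "(\<lambda>w. f (\<phi> w)) holomorphic_on S"
    using analytic_on_compose[of \<phi> S f] \<phi> S by (simp add: o_def analytic_imp_holomorphic analytic_on_open)
  then have "G holomorphic_on S"
    unfolding G_def using \<phi>(1) S(1) nz(1)[of _ 0]
    by (intro holomorphic_on_mult holomorphic_on_divide holomorphic_on_power holomorphic_deriv) auto
  then have contG: "continuous_on (closed_segment 0 (of_real up)) G"
    using S(2) holomorphic_on_imp_continuous_on continuous_on_subset by blast
  have cont\<phi>: "continuous_on (closed_segment 0 (of_real up)) \<phi>"
    using S(2) \<phi>(1) holomorphic_on_imp_continuous_on continuous_on_subset by blast
  have swap: "contour_integral ?lp (\<lambda>w. contour_integral (linepath 0 1) (K w)) =
        contour_integral (linepath 0 1) (\<lambda>s. contour_integral ?lp (\<lambda>w. K w s))"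
  proof (rule contour_integral_swap)
    have "continuous_on (closed_segment 0 (of_real up) \<times> closed_segment 0 1) (\<lambda>p. G (fst p))"
      "continuous_on (closed_segment 0 (of_real up) \<times> closed_segment 0 1) (\<lambda>p. \<phi> (fst p))"
      "continuous_on (closed_segment 0 (of_real up) \<times> closed_segment 0 (1::complex)) (\<lambda>p. r (Re (snd p)))"
      by (rule continuous_on_compose2[OF contG] continuous_on_compose2[OF cont\<phi>]
          continuous_on_compose2[OF r(1)]; use Re_seg in \<open>force intro!: continuous_intros\<close>)+
    moreover have "\<phi> (fst p) - of_real (r (Re (snd p))) \<noteq> 0"
      if "p \<in> closed_segment 0 (of_real up) \<times> closed_segment 0 1" for p
      using nz(2)[of "fst p" "Re (snd p)"] S(2) Re_seg[of "snd p"] that by auto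
    ultimately show "continuous_on (path_image ?lp \<times> path_image (linepath 0 1)) (\<lambda>(w, s). K w s)"
      unfolding K_def case_prod_unfold path_image_linepath by (intro continuous_intros) auto
  qed auto
  have "of_real \<alpha> * contour_integral ?lp (integrand n \<alpha> f \<phi>) =
      contour_integral ?lp (\<lambda>w. of_real \<alpha> * integrand n \<alpha> f \<phi> w)"
    by (intro contour_integral_lmul[symmetric] contour_integrable_holomorphic_simple[OF
          holomorphic_integrand[OF \<alpha> \<phi>(1) S(1) \<phi>(2,3)] S(1)]) (use S(2) in auto)
  also have "\<dots> = contour_integral ?lp (\<lambda>w. contour_integral (linepath 0 1) (K w))"
    by (intro contour_integral_eq) (use int_K S(2) in auto)
  also note swap
  also have "contour_integral (linepath 0 1) (\<lambda>s. contour_integral ?lp (\<lambda>w. K w s))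
      = integral {0..1} (\<lambda>t. contour_integral ?lp (\<lambda>w. K w (of_real t)))"
    by (simp add: contour_integral_linepath_Reals_eq)
  also have "\<dots> = integral {0..1} (\<lambda>t. 2 * pi * \<i> * g (of_real (r t)))"
    using int_w by (intro integral_cong) auto
  also have "\<dots> = 2 * pi * \<i> * integral {0..1} (\<lambda>t. g (of_real (r t)))"
    by (rule integral_mult_right)
  finally show ?thesis
    using \<alpha> by (simp add: r_def field_simps)
qed

section \<open>Periodicity in the strip and the maximum on two horizontal lines\<close>

lemma periodic_on_strip:
  assumes d: "0 < d" and \<phi>: "\<phi> holomorphic_on strip d"
    and per: "\<And>u::real. \<phi> (of_real (u + p)) = \<phi> (of_real u)"
    and w: "w \<in> strip d"
  shows "\<phi> (w + of_real p) = \<phi> w"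
proof -
  \<comment> \<open>Identity theorem: the difference is holomorphic on the connected strip and
    vanishes on the real axis, where \<open>0\<close> is an accumulation point.\<close>
  have "\<phi> (w + of_real p) - \<phi> w = 0"
  proof (rule analytic_continuation[of "\<lambda>w. \<phi> (w + of_real p) - \<phi> w" "strip d" "\<real>" 0 w])
    show "(\<lambda>w. \<phi> (w + of_real p) - \<phi> w) holomorphic_on strip d"
      by (intro holomorphic_on_diff holomorphic_on_strip_translate \<phi>)
    show "\<phi> (z + of_real p) - \<phi> z = 0" if "z \<in> \<real>" for z
      using that per by (auto elim!: Reals_cases simp flip: of_real_add)
    show "\<real> \<subseteq> strip d"
      using d by (auto elim!: Reals_cases simp: strip_def)
    show "(0::complex) islimpt \<real>"
    proof (rule islimptI)
      fix T :: "complex set" assume "0 \<in> T" "open T"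
      then obtain e where e: "0 < e" "ball 0 e \<subseteq> T"
        using openE by blast
      then have "of_real (e / 2) \<in> T" by (auto simp: subset_iff)
      then show "\<exists>y\<in>\<real>. y \<in> T \<and> y \<noteq> 0"
        using e(1) by (intro bexI[of _ "of_real (e / 2)"]) auto
    qed
  qed (use w d open_strip convex_strip convex_connected in \<open>auto simp: strip_def\<close>)
  then show ?thesis by simp
qed

lemma integrand_periodic:
  assumes per: "\<And>w. w \<in> strip d \<Longrightarrow> \<phi> (w + of_real p) = \<phi> w"
    and \<phi>: "\<phi> holomorphic_on strip d" and w: "w \<in> strip d"
  shows "integrand n \<alpha> f \<phi> (w + of_real p) = integrand n \<alpha> f \<phi> w"
proof -
  have "(\<phi> has_field_derivative deriv \<phi> (w + of_real p)) (at (w + of_real p))"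
    using \<phi> open_strip w by (intro holomorphic_derivI) auto
  then have "((\<lambda>w. \<phi> (w + of_real p)) has_field_derivative deriv \<phi> (w + of_real p)) (at w)"
    by (simp add: DERIV_shift)
  then have "(\<phi> has_field_derivative deriv \<phi> (w + of_real p)) (at w)"
    by (rule has_field_derivative_transform_within_open[OF _ open_strip w per])
  then have "deriv \<phi> (w + of_real p) = deriv \<phi> w"
    using DERIV_imp_deriv by metis
  then show ?thesis
    using per[OF w] by (simp add: integrand_def)
qed

text \<open>By periodicity the values on the two infinite lines are already taken on the compact set
  \<open>B\<close>, one period of each line. Hence the supremum is attained and
  \<open>GREATEST\<close> denotes a true maximum.\<close>

lemma norm_le_max_on_lines:
  fixes F :: "complex \<Rightarrow> complex"
  assumes F: "continuous_on (strip d) F" and p: "0 < p"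
    and per: "\<And>w. w \<in> strip d \<Longrightarrow> F (w + of_real p) = F w"
    and d': "0 < d'" "d' < d" and w: "\<bar>Im w\<bar> = d'"
  shows "norm (F w) \<le> (GREATEST m. m \<in> (\<lambda>w. norm (F w)) ` {w. \<bar>Im w\<bar> = d'})"
proof -
  define B where "B = cbox (Complex 0 (- d')) (Complex p d') \<inter> {w. \<bar>Im w\<bar> = d'}"
  have "compact B"
    unfolding B_def by (intro compact_Int_closed compact_cbox closed_Collect_eq continuous_intros)
  moreover have "Complex 0 d' \<in> B"
    using p d' by (auto simp: B_def in_cbox_complex_iff)
  moreover have "continuous_on B (\<lambda>w. norm (F w))"
    using d' by (intro continuous_on_norm continuous_on_subset[OF F]) (auto simp: B_def strip_def)
  ultimately obtain b where b: "b \<in> B" "\<And>z. z \<in> B \<Longrightarrow> norm (F z) \<le> norm (F b)"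
    using continuous_attains_sup[of B "\<lambda>w. norm (F w)"] by blast
  have shift: "F (z + of_real (real k * p)) = F z" if "z \<in> strip d" for z k
    using that
  proof (induction k)
    case (Suc k)
    then show ?case
      using per[of "z + of_real (real k * p)"] by (simp add: algebra_simps strip_def)
  qed simp
  have shift_int: "F (z + of_real (of_int k * p)) = F z" if z: "z \<in> strip d" for z and k :: int
  proof (cases "0 \<le> k")
    case True
    then show ?thesis using shift[OF z, of "nat k"] by simp
  next
    case False
    \<comment> \<open>For negative \<open>k\<close> the forward shift starts at the translated point
      and leads back to \<open>z\<close>.\<close>
    have "F (z + of_real (of_int k * p) + of_real (real (nat (- k)) * p)) = F (z + of_real (of_int k * p))"
      by (rule shift) (use z in \<open>simp del: of_real_mult\<close>)
    then show ?thesis using False by simp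
  qed
  have le: "norm (F z) \<le> norm (F b)" if z: "\<bar>Im z\<bar> = d'" for z
  proof -
    define k where "k = - \<lfloor>Re z / p\<rfloor>"
    have zs: "z \<in> strip d" using z d' by (simp add: strip_def)
    have "of_int \<lfloor>Re z / p\<rfloor> * p \<le> Re z" "Re z < (of_int \<lfloor>Re z / p\<rfloor> + 1) * p"
      using p floor_divide_lower[OF p, of "Re z"] floor_divide_upper[OF p, of "Re z"] by auto
    then have "z + of_real (of_int k * p) \<in> B"
      using z d' by (auto simp: B_def in_cbox_complex_iff k_def algebra_simps)
    from b(2)[OF this] show ?thesis
      unfolding shift_int[OF zs] .
  qed
  have "(GREATEST m. m \<in> (\<lambda>w. norm (F w)) ` {w. \<bar>Im w\<bar> = d'}) = norm (F b)"
    by (rule Greatest_equality) (use b(1) le in \<open>auto simp: B_def\<close>)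
  then show ?thesis using le[OF w] by simp
qed

section \<open>Assembly of the error estimate\<close>

theorem theorem2:
  fixes \<alpha> d d' up :: real and n N :: nat
    and f \<phi> :: "complex \<Rightarrow> complex" and D :: "complex set"
  assumes "0 < \<alpha>" and "\<alpha> < 1" and "n \<ge> 1" and "N \<ge> 1"
    and "open D" and "connected D" and "closed_segment 0 1 \<subseteq> D" and "f analytic_on D"
    and "up > 0" and "\<And>u::real. \<phi> (complex_of_real (u + up)) = \<phi> (complex_of_real u)"
    and "path_image (param_path \<phi> up) \<subseteq> D - closed_segment 0 1"
    and "encircles_in (param_path \<phi> up) (closed_segment 0 1) D"
    and "d > 0" and "\<phi> analytic_on strip d"
    and "\<phi> ` strip d \<subseteq> - closed_segment 0 1"
    and "f analytic_on \<phi> ` strip d"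
    and "0 < d'" and "d' < d"
  shows "norm (finite_part_integral n \<alpha> f - trapezoidal_approx N n \<alpha> f \<phi> up)
       \<le> up / pi * max_norm n \<alpha> f \<phi> d' *
          (exp (- 2 * pi * d' * real N / up) / (1 - exp (- 2 * pi * d' * real N / up)))"
proof -
  have \<phi>: "\<phi> holomorphic_on strip d" and f: "f holomorphic_on D"
    using assms by (auto intro: analytic_imp_holomorphic)
  have "0 \<in> D" using assms(7) by auto
  then obtain g where g: "g holomorphic_on D"
    "\<And>z. z \<in> D \<Longrightarrow> f z = (\<Sum>k<n. (deriv ^^ k) f 0 / fact k * z ^ k) + z ^ n * g z"
    using Taylor_remainder_holomorphic[OF f assms(5), of n] by blast
  have per: "\<phi> (w + of_real up) = \<phi> w" if "w \<in> strip d" for w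
    by (rule periodic_on_strip[OF \<open>d > 0\<close> \<phi> assms(10) that])
  let ?I = "integrand n \<alpha> f \<phi>"
  have I_hol: "?I holomorphic_on strip d"
    using assms(1) \<phi> open_strip assms(15,16) by (rule holomorphic_integrand)
  have I_per: "?I (w + of_real up) = ?I w" if "w \<in> strip d" for w
    using integrand_periodic[OF per \<phi> that] .
  define M where "M = max_norm n \<alpha> f \<phi> d'"
  define R where "R = exp (- 2 * pi * d' * real N / up) / (1 - exp (- 2 * pi * d' * real N / up))"
  define S where "S = (\<Sum>k<N. ?I (of_real (real k * (up / N))))"
  define J where "J = contour_integral (linepath 0 (of_real up)) ?I"
  define T where "T = (\<Sum>k<n. (deriv ^^ k) f 0 / complex_of_real (fact k * (\<alpha> - real n + real k)))"
  have M: "norm (?I w) \<le> M" if "\<bar>Im w\<bar> = d'" for w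
    unfolding M_def max_norm_def
    by (rule norm_le_max_on_lines[OF holomorphic_on_imp_continuous_on[OF I_hol] assms(9) I_per assms(17,18) that])
  have est: "norm (J - of_real (up / N) * S) \<le> 2 * up * M * R"
    unfolding J_def S_def R_def
    by (rule trapezoidal_error_periodic[OF I_hol I_per assms(9,4,17,18) M])
  have seg: "closed_segment 0 (of_real up) \<subseteq> strip d"
    using assms(13) by (intro closed_segment_subset convex_strip) (auto simp: strip_def)
  have vp: "valid_path (param_path \<phi> up)"
    unfolding param_path_def using seg by (intro valid_path_compose_holomorphic[OF _ \<phi> open_strip]) auto
  have loop: "pathfinish (param_path \<phi> up) = pathstart (param_path \<phi> up)"
    using assms(10)[of 0] by (simp add: param_path_def pathfinish_compose pathstart_compose)
  have wn: "winding_number (param_path \<phi> up) z = 1" if "z \<in> closed_segment 0 1" for z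
    using assms(12) that by (simp add: encircles_in_def)
  have "((\<lambda>z. f z / z ^ n / (z - x)) has_contour_integral (2 * pi * \<i> * g x)) (param_path \<phi> up)"
    if x: "x \<in> closed_segment 0 1" for x
  proof (rule has_contour_integral_Taylor_remainder[OF assms(5) _ g vp loop])
    show "path_image (param_path \<phi> up) \<subseteq> D - {0, x}"
      using assms(11) x by auto
    show "winding_number (param_path \<phi> up) z = 0" if "z \<notin> D" for z
      using assms(12) that by (simp add: encircles_in_def)
  qed (use wn x assms(7) in auto)
  then have J: "J = 2 * pi * \<i> * (integral {0..1} (\<lambda>t. g (of_real (t powr (1 / \<alpha>)))) / of_real \<alpha>)"
    unfolding J_def
    using contour_integral_integrand[OF assms(1,9) open_strip seg \<phi> assms(15,16)] by blast
  have "finite_part_integral n \<alpha> f = integral {0..1} (\<lambda>t. g (of_real (t powr (1 / \<alpha>)))) / of_real \<alpha> + T"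
    unfolding T_def
  proof (rule finite_part_integral_eq[OF assms(1,2)])
    show "continuous_on (closed_segment 0 1) g"
      using g(1) assms(7) holomorphic_on_imp_continuous_on continuous_on_subset by blast
  qed (use g(2) assms(7) in auto)
  \<comment> \<open>The trapezoidal formula contains the same sum \<open>T\<close>, which cancels.
    What remains is the quadrature error for \<open>J\<close> divided by
    \<open>2 * pi * \<i>\<close>, which turns \<open>2 * up\<close> into
    \<open>up / pi\<close>.\<close>
  then have "finite_part_integral n \<alpha> f = J / (2 * pi * \<i>) + T"
    unfolding J by simp
  moreover have "trapezoidal_approx N n \<alpha> f \<phi> up = of_real (up / N) * S / (2 * pi * \<i>) + T"
    by (simp add: trapezoidal_approx_def Let_def S_def T_def)
  ultimately have "finite_part_integral n \<alpha> f - trapezoidal_approx N n \<alpha> f \<phi> up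
      = (J - of_real (up / N) * S) / (2 * pi * \<i>)"
    by (simp only: diff_divide_distrib add_diff_cancel_right)
  then have "norm (finite_part_integral n \<alpha> f - trapezoidal_approx N n \<alpha> f \<phi> up)
      = norm (J - of_real (up / N) * S) / (2 * pi)"
    by (simp only: norm_divide norm_mult) simp
  also have "\<dots> \<le> 2 * up * M * R / (2 * pi)"
    using est by (intro divide_right_mono) auto
  also have "\<dots> = up / pi * M * R"
    by simp
  finally show ?thesis
    unfolding M_def R_def .
qed

end
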